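(* Let $f:\mathbb{R}^n\to\mathbb{R}$ be continuously differentiable, let $\varphi:\mathbb{R}^n\to(-\infty,+\infty]$ be convex, lower semicontinuous and proper, and let $\psi=f+\varphi$. Let the random process $(\mathsf X^k)_k$ be generated by the stochastic extra-step method described in the context, using parameter matrices $\Lambda_k=\lambda_k^{-1}I$ and $\Lambda_{k,+}=\lambda_{k,+}^{-1}I$ with $\lambda_k,\lambda_{k,+}>0$. Suppose: (A.1) $\nabla f$ is Lipschitz continuous on $\mathbb{R}^n$ with modulus $L_f\ge 1$; (A.2) $\psi$ is bounded from below on $\mathrm{dom}\,\varphi$; (B.1) $\mathsf D^k:\Omega\to\mathbb{R}^n$ is $\mathcal F^k$-measurable for all $k$; (B.2) for all $k$ there is $\nu_k>0$ such that $\mathbb{E}[\|\mathsf D^k\|^2\mid\mathcal F_+^{k-1}]\le\nu_k^2\cdot\mathbb{E}[\|F^{\Lambda_k}_{\mathsf V^k}(\mathsf X^k)\|^2\mid\mathcal F_+^{k-1}]$ a.e.; (B.3) for all $k$ it holds that $\mathbb{E}[\mathsf V^k\mid\mathcal F_+^{k-1}]=\nabla f(\mathsf X^k)$ and $\mathbb{E}[\mathsf V_+^k\mid\mathcal F^k]=\nabla f(\mathsf Z^k)$ a.e., and there are $\sigma_k,\sigma_{k,+}>0$ such that a.e. $$\mathbb{E}[\|\nabla f(\mathsf X^k)-\mathsf V^k\|^2\mid\mathcal F_+^{k-1}]\le\sigma_k^2,\qquad \mathbb{E}[\|\nabla f(\mathsf Z^k)-\mathsf V_+^k\|^2\mid\mathcal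 F^k]\le\sigma_{k,+}^2 .$$ Assume that the step sizes satisfy, for all $k$ and some $\bar\rho\in(0,1)$, $$\lambda_{k,+}\le\frac1{L_f},\qquad \lambda_k\le\frac{(1-\bar\rho)\lambda_{k,+}}{1+\nu_k^2(\alpha_k+L_f\beta_k\lambda_{k,+})^2},$$ and that $$\sum_k\lambda_k=\infty,\qquad \sum_k\lambda_k\sigma_k^2<\infty,\qquad \sum_k\lambda_{k,+}\sigma_{k,+}^2<\infty .$$ Then $\liminf_{k\to\infty}\mathbb{E}[\|F^I(\mathsf X^k)\|^2]=0$ and $\liminf_{k\to\infty}\|F^I(\mathsf X^k)\|=0$ almost surely, and $(\psi(\mathsf X^k))_k$ converges almost surely to a random variable $\mathsf Y^*$ with $\lim_{k\to\infty}\mathbb{E}[\psi(\mathsf X^k)]=\mathbb{E}[\mathsf Y^*]$.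
   Context: $\|\cdot\|$ is the Euclidean norm. For a symmetric positive definite matrix $\Lambda\in\mathbb{R}^{n\times n}$ let $\|x\|_\Lambda=\sqrt{\langle x,\Lambda x\rangle}$ and $\mathrm{prox}^\Lambda_\varphi(x)=\mathrm{argmin}_y\ \varphi(y)+\frac12\|x-y\|_\Lambda^2$. For $v\in\mathbb{R}^n$, $F^\Lambda_v(x):=x-\mathrm{prox}^\Lambda_\varphi(x-\Lambda^{-1}v)$ and $F^\Lambda(x):=F^\Lambda_{\nabla f(x)}(x)$; $F^I$ is the case $\Lambda=I$ (identity). Stochastic extra-step method: let $(\Omega,\mathcal F,\mathbb P)$ be a probability space, $x^0\in\mathrm{dom}\,\varphi$ deterministic, $(\alpha_k)_k,(\beta_k)_k$ deterministic nonnegative step sizes, $(\lambda_k)_k,(\lambda_{k,+})_k$ deterministic positive numbers. Set $\mathsf X^0=x^0$ and for $k=0,1,2,\dots$: given a random vector $\mathsf V^k:\Omega\to\mathbb{R}^n$ (stochastic approximation of $\nabla f(\mathsf X^k)$), choose a random direction $\mathsf D^k:\Omega\to\mathbb{R}^n$ and set $\mathsf Z^k=\mathsf X^k+\beta_k\mathsf D^k$; given a random vector $\mathsf V_+^k:\Omega\to\mathbb{R}^n$ (stochastic approximation of $\nabla f(\mathsf Z^k)$), set $$\mathsf X^{k+1}=\mathrm{prox}^{\Lambda_{k,+}}_\varphi\big(\mathsf X^k+\alpha_k\mathsf D^k-\Lambda_{k,+}^{-1}\mathsf V_+^k\big).$$ Filtrations: $\mathcal F^k:=\sigma(\mathsf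 V^0,\mathsf V^0_+,\dots,\mathsf V^{k-1},\mathsf V_+^{k-1},\mathsf V^k)$ and $\mathcal F^k_+:=\sigma(\mathcal F^k\cup\sigma(\mathsf V_+^k))$, with $\mathcal F_+^{-1}$ the trivial $\sigma$-algebra. *)

theory Defs
  imports "HOL-Probability.Probability"
begin

definition grad :: "(real^'n \<Rightarrow> real) \<Rightarrow> real^'n \<Rightarrow> real^'n" where
  "grad f x = (THE D. GDERIV f x :> D)"

definition cont_diff :: "(real^'n \<Rightarrow> real) \<Rightarrow> bool" where
  "cont_diff f \<longleftrightarrow> (\<forall>x. f differentiable (at x)) \<and> continuous_on UNIV (grad f)"

text \<open>Functions with values in \<open>(-\<infinity>, +\<infinity>]\<close> are \<open>ereal\<close>-valued functions that avoid
  \<open>-\<infinity>\<close>. Since \<open>0 * \<infinity> = 0\<close> in \<open>ereal\<close>, the cases \<open>u = 0\<close> and \<open>v = 0\<close> in the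
  convexity inequality are trivial.\<close>

definition domain_of :: "(real^'n \<Rightarrow> ereal) \<Rightarrow> (real^'n) set" where
  "domain_of \<phi> = {x. \<phi> x < \<infinity>}"

definition proper_fun :: "(real^'n \<Rightarrow> ereal) \<Rightarrow> bool" where
  "proper_fun \<phi> \<longleftrightarrow> (\<forall>x. \<phi> x \<noteq> -\<infinity>) \<and> domain_of \<phi> \<noteq> {}"

definition convex_fun :: "(real^'n \<Rightarrow> ereal) \<Rightarrow> bool" where
  "convex_fun \<phi> \<longleftrightarrow> (\<forall>x y. \<forall>u\<ge>0. \<forall>v\<ge>0. u + v = 1 \<longrightarrow>
     \<phi> (u *\<^sub>R x + v *\<^sub>R y) \<le> ereal u * \<phi> x + ereal v * \<phi> y)"

definition lsc_fun :: "(real^'n \<Rightarrow> ereal) \<Rightarrow> bool" where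
  "lsc_fun \<phi> \<longleftrightarrow> (\<forall>x. \<phi> x \<le> Liminf (at x) \<phi>)"

definition norm_wrt :: "real^'n^'n \<Rightarrow> real^'n \<Rightarrow> real" where
  "norm_wrt \<Lambda> x = sqrt (x \<bullet> (\<Lambda> *v x))"

definition prox :: "real^'n^'n \<Rightarrow> (real^'n \<Rightarrow> ereal) \<Rightarrow> real^'n \<Rightarrow> real^'n" where
  "prox \<Lambda> \<phi> x =
     arg_min (\<lambda>y. \<phi> y + ereal (1/2 * (norm_wrt \<Lambda> (x - y))\<^sup>2)) (\<lambda>_. True)"

text \<open>\<open>residual_at \<Lambda> \<phi> v x\<close> is \<open>F\<^sup>\<Lambda>\<close> at \<open>x\<close> with the gradient replaced by \<open>v\<close>, and
  \<open>residual \<Lambda> f \<phi> x\<close> is \<open>F\<^sup>\<Lambda>\<close> itself.\<close>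

definition residual_at :: "real^'n^'n \<Rightarrow> (real^'n \<Rightarrow> ereal) \<Rightarrow> real^'n \<Rightarrow> real^'n \<Rightarrow> real^'n" where
  "residual_at \<Lambda> \<phi> v x = x - prox \<Lambda> \<phi> (x - matrix_inv \<Lambda> *v v)"

definition residual ::
  "real^'n^'n \<Rightarrow> (real^'n \<Rightarrow> real) \<Rightarrow> (real^'n \<Rightarrow> ereal) \<Rightarrow> real^'n \<Rightarrow> real^'n" where
  "residual \<Lambda> f \<phi> x = residual_at \<Lambda> \<phi> (grad f x) x"

definition generated_by :: "'a measure \<Rightarrow> ('a \<Rightarrow> real^'n) \<Rightarrow> 'a measure" where
  "generated_by M V = vimage_algebra (space M) V borel"

text \<open>The subscript \<open>p\<close> stands for the subscript \<open>+\<close> of the mathematical notation.\<close>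

definition filt ::
  "'a measure \<Rightarrow> (nat \<Rightarrow> 'a \<Rightarrow> real^'n) \<Rightarrow> (nat \<Rightarrow> 'a \<Rightarrow> real^'n) \<Rightarrow> nat \<Rightarrow> 'a measure" where
  "filt M V V\<^sub>p k = sigma (space M)
     ((\<Union>i\<le>k. sets (generated_by M (V i))) \<union> (\<Union>i<k. sets (generated_by M (V\<^sub>p i))))"

definition filt_plus ::
  "'a measure \<Rightarrow> (nat \<Rightarrow> 'a \<Rightarrow> real^'n) \<Rightarrow> (nat \<Rightarrow> 'a \<Rightarrow> real^'n) \<Rightarrow> nat \<Rightarrow> 'a measure" where
  "filt_plus M V V\<^sub>p k = sigma (space M)
     (sets (filt M V V\<^sub>p k) \<union> sets (generated_by M (V\<^sub>p k)))"

text \<open>\<open>filt_plus_pred M V V\<^sub>p k\<close> is the \<open>(k-1)\<close>-st member of \<open>filt_plus\<close>; the member with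
  index \<open>-1\<close> is the trivial \<open>\<sigma>\<close>-algebra.\<close>

definition filt_plus_pred ::
  "'a measure \<Rightarrow> (nat \<Rightarrow> 'a \<Rightarrow> real^'n) \<Rightarrow> (nat \<Rightarrow> 'a \<Rightarrow> real^'n) \<Rightarrow> nat \<Rightarrow> 'a measure" where
  "filt_plus_pred M V V\<^sub>p k =
     (case k of 0 \<Rightarrow> sigma (space M) {} | Suc j \<Rightarrow> filt_plus M V V\<^sub>p j)"

definition vec_cond_exp ::
  "'a measure \<Rightarrow> 'a measure \<Rightarrow> ('a \<Rightarrow> real^'n) \<Rightarrow> 'a \<Rightarrow> real^'n" where
  "vec_cond_exp M F V \<omega> = (\<chi> i. real_cond_exp M F (\<lambda>\<omega>. V \<omega> $ i) \<omega>)"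

text \<open>Conditional second moment, with values in \<open>[0, \<infinity>]\<close>, so no integrability is presupposed.\<close>

definition cond_sq_norm ::
  "'a measure \<Rightarrow> 'a measure \<Rightarrow> ('a \<Rightarrow> real^'n) \<Rightarrow> 'a \<Rightarrow> ennreal" where
  "cond_sq_norm M F V = nn_cond_exp M F (\<lambda>\<omega>. ennreal ((norm (V \<omega>))\<^sup>2))"

definition stochastic_extra_step ::
  "'a measure \<Rightarrow> (real^'n \<Rightarrow> ereal) \<Rightarrow> real^'n \<Rightarrow> (nat \<Rightarrow> real) \<Rightarrow> (nat \<Rightarrow> real) \<Rightarrow>
   (nat \<Rightarrow> real^'n^'n) \<Rightarrow> (nat \<Rightarrow> 'a \<Rightarrow> real^'n) \<Rightarrow> (nat \<Rightarrow> 'a \<Rightarrow> real^'n) \<Rightarrow>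
   (nat \<Rightarrow> 'a \<Rightarrow> real^'n) \<Rightarrow> (nat \<Rightarrow> 'a \<Rightarrow> real^'n) \<Rightarrow> (nat \<Rightarrow> 'a \<Rightarrow> real^'n) \<Rightarrow> bool" where
  "stochastic_extra_step M \<phi> x0 \<alpha> \<beta> \<Lambda>\<^sub>p V D V\<^sub>p X Z \<longleftrightarrow>
     x0 \<in> domain_of \<phi> \<and> (\<forall>k. 0 \<le> \<alpha> k) \<and> (\<forall>k. 0 \<le> \<beta> k) \<and>
     (\<forall>k. V k \<in> borel_measurable M) \<and> (\<forall>k. D k \<in> borel_measurable M) \<and>
     (\<forall>k. V\<^sub>p k \<in> borel_measurable M) \<and>
     (\<forall>\<omega>\<in>space M. X 0 \<omega> = x0 \<and>
        (\<forall>k. Z k \<omega> = X k \<omega> + \<beta> k *\<^sub>R D k \<omega> \<and>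
             X (Suc k) \<omega> = prox (\<Lambda>\<^sub>p k) \<phi>
               (X k \<omega> + \<alpha> k *\<^sub>R D k \<omega> - matrix_inv (\<Lambda>\<^sub>p k) *v V\<^sub>p k \<omega>)))"

end

theory Submission
  imports Defs
begin

text \<open>Write \<open>x = X k\<close>, \<open>p = X (k + 1)\<close>, let \<open>y\<close> be the proximal gradient point of \<open>x\<close> with
  parameter \<open>lam k\<close> and direction \<open>V k\<close>, and \<open>F = x - y\<close>. The descent lemma for \<open>f\<close> and the
  variational inequalities of the two proximal points give, pathwise,
  \<open>\<psi>(p) \<le> \<psi>(x) + a + b + r\<close>, where \<open>a\<close> and \<open>b\<close> are martingale differences (gradient errors paired
  with predictable vectors) and \<open>r\<close> collects squares. The step size rule and the bound on \<open>D\<close> make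
  \<open>E r\<close> at most \<open>- \<rho> E|F|\<^sup>2 / lam - E|p - y|\<^sup>2 / (4 lam\<^sub>p)\<close> plus the summable noise
  \<open>lam \<sigma>\<^sup>2 + lam\<^sub>p \<sigma>\<^sub>p\<^sup>2\<close>. Summing, \<open>E|F|\<^sup>2 / lam\<close> and \<open>E|p - y|\<^sup>2 / lam\<^sub>p\<close> are summable; since \<open>F\<close>
  dominates \<open>lam\<close> times the natural residual up to noise, both liminf claims follow from
  \<open>\<Sum> lam = \<infinity>\<close>. The same bounds show \<open>\<Sum> E a\<^sup>2 < \<infinity>\<close>, \<open>\<Sum> E b\<^sup>2 < \<infinity>\<close> and \<open>\<Sum> E|r| < \<infinity>\<close>, so
  \<open>\<Sum> (a + b + r)\<close> converges almost surely and in mean, and subtracting its partial sums from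
  \<open>\<psi>(X k)\<close> leaves a pathwise decreasing sequence to which monotone convergence applies.\<close>

section \<open>Proximal points and the one-step inequality\<close>

text \<open>Supermartingale convergence would give an almost sure limit of \<psi>(X k), but Fatou's
  lemma then compares its expectation with the limit of the expectations in one direction only.
  Asking for equality is what forces both martingale parts to be controlled in L2 and
  \<open>r\<close> in L1. The bound on D holds in conditional expectation, not pathwise, so the step
  size rule acts only after integration, and \<open>r\<close> keeps its separate squares until then.
  The two gradient errors are centred given different information, that of Vp only once V has been
  revealed; hence \<open>a\<close> and \<open>b\<close> are martingale differences along two
  interleaved filtrations.\<close>

lemma lsc_attains_inf:
  fixes g :: "'a::topological_space \<Rightarrow> 'b::linorder"
  assumes "compact K" "K \<noteq> {}" and op: "\<And>c. open {x. c < g x}"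
  shows "\<exists>x\<in>K. \<forall>y\<in>K. g x \<le> g y"
proof (rule ccontr)
  assume "\<not> ?thesis"
  then have *: "\<And>x. x \<in> K \<Longrightarrow> \<exists>y\<in>K. g y < g x" by (auto simp: not_le)
  then have "K \<subseteq> (\<Union>y\<in>K. {x. g y < g x})" by blast
  then obtain Y where Y: "Y \<subseteq> K" "finite Y" "K \<subseteq> (\<Union>y\<in>Y. {x. g y < g x})"
    using compactE_image[OF \<open>compact K\<close>, of K "\<lambda>y. {x. g y < g x}"] op by metis
  with \<open>K \<noteq> {}\<close> have "Y \<noteq> {}" by auto
  then have "Min (g ` Y) \<in> g ` Y" using Y by (intro Min_in) auto
  then obtain y0 where y0: "y0 \<in> Y" "g y0 = Min (g ` Y)" by auto
  \<comment> \<open>The point \<open>y0\<close> has the least value among Y, yet it lies in K and so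
    in a member of the subcover, which asks for a still smaller value.\<close>
  then obtain y where "y \<in> Y" "g y < g y0" using Y by blast
  then show False using y0 Y(2) by (simp add: leD)
qed

lemma norm_add_scaleR_sq:
  fixes a b :: "'a::real_inner"
  shows "(norm (a + s *\<^sub>R b))\<^sup>2 = (norm a)\<^sup>2 + 2 * s * (a \<bullet> b) + s\<^sup>2 * (norm b)\<^sup>2"
  by (simp only: power2_norm_eq_inner) (simp add: inner_simps inner_commute power2_eq_square)

lemma norm_wrt_scaled_mat_1:
  "0 < t \<Longrightarrow> (norm_wrt (inverse t *\<^sub>R mat 1) x)\<^sup>2 = (norm x)\<^sup>2 / t"
  by (simp add: norm_wrt_def scaleR_matrix_vector_assoc[symmetric] power2_norm_eq_inner field_simps)

lemma matrix_inv_scaled_mat_1: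
  fixes v :: "real^'n"
  assumes "0 < t"
  shows "matrix_inv (inverse t *\<^sub>R mat 1) *v v = t *\<^sub>R v"
proof -
  let ?A = "inverse t *\<^sub>R mat 1 :: real^'n^'n"
  have scale: "(c *\<^sub>R mat 1 :: real^'n^'n) ** (d *\<^sub>R mat 1) = (c * d) *\<^sub>R mat 1" for c d
    by (simp add: matrix_eq matrix_vector_mul_assoc[symmetric] scaleR_matrix_vector_assoc[symmetric]
      matrix_vector_mult_scaleR)
  have "?A ** (t *\<^sub>R mat 1) = mat 1 \<and> (t *\<^sub>R mat 1) ** ?A = mat 1"
    using assms by (simp add: scale)
  \<comment> \<open>\<open>matrix_inv\<close> is a choice among two-sided inverses; the witness just
    found makes the choice meaningful.\<close>
  then have "?A ** matrix_inv ?A = mat 1"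
    unfolding matrix_inv_def by (rule someI2) simp
  then have "?A *v (matrix_inv ?A *v v) = v"
    by (simp add: matrix_vector_mul_assoc)
  then have "t *\<^sub>R (?A *v (matrix_inv ?A *v v)) = t *\<^sub>R v" by simp
  then show ?thesis
    using assms by (simp add: scaleR_matrix_vector_assoc[symmetric])
qed

section \<open>Proximal maps of convex lower semicontinuous functions\<close>

locale convex_lsc_proper =
  fixes \<phi> :: "real^'n \<Rightarrow> ereal"
  assumes proper: "proper_fun \<phi>" and convex: "convex_fun \<phi>" and lsc: "lsc_fun \<phi>"
begin

abbreviation dom where "dom \<equiv> domain_of \<phi>"
abbreviation \<phi>r where "\<phi>r x \<equiv> real_of_ereal (\<phi> x)"
definition px :: "real \<Rightarrow> real^'n \<Rightarrow> real^'n" where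
  "px t u = prox (inverse t *\<^sub>R mat 1) \<phi> u"

lemma not_minf: "\<phi> x \<noteq> -\<infinity>"
  using proper by (auto simp: proper_fun_def)

lemma dom_ereal: "x \<in> dom \<Longrightarrow> \<phi> x = ereal (\<phi>r x)"
  using not_minf[of x] by (cases "\<phi> x") (auto simp: domain_of_def)

lemma not_dom: "x \<notin> dom \<Longrightarrow> \<phi> x = \<infinity>"
  by (auto simp: domain_of_def)

lemma convex_dom:
  assumes "x \<in> dom" "y \<in> dom" "0 \<le> u" "u \<le> 1"
  shows "(1 - u) *\<^sub>R x + u *\<^sub>R y \<in> dom"
    and "\<phi>r ((1 - u) *\<^sub>R x + u *\<^sub>R y) \<le> (1 - u) * \<phi>r x + u * \<phi>r y"
proof -
  let ?z = "(1 - u) *\<^sub>R x + u *\<^sub>R y"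
  have "\<phi> ?z \<le> ereal (1 - u) * \<phi> x + ereal u * \<phi> y"
    using convex assms unfolding convex_fun_def by simp
  also have "\<dots> = ereal ((1 - u) * \<phi>r x + u * \<phi>r y)"
    using dom_ereal[OF assms(1)] dom_ereal[OF assms(2)]
    by (metis plus_ereal.simps(1) times_ereal.simps(1))
  finally have le: "\<phi> ?z \<le> ereal ((1 - u) * \<phi>r x + u * \<phi>r y)" .
  show D: "?z \<in> dom"
    using le by (auto simp: domain_of_def)
  show "\<phi>r ?z \<le> (1 - u) * \<phi>r x + u * \<phi>r y"
    using le dom_ereal[OF D] by (metis ereal_less_eq(3))
qed

text \<open>\<open>lsc_fun\<close> speaks of the punctured filter \<open>at x\<close>; the
  assumption supplies the point x itself and so closes the gap to \<open>nhds x\<close>.\<close>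

lemma eventually_greater:
  assumes "c < \<phi> x" shows "\<forall>\<^sub>F y in nhds x. c < \<phi> y"
proof -
  have "c < Liminf (at x) \<phi>" using assms lsc by (auto simp: lsc_fun_def intro: less_le_trans)
  then show ?thesis using assms less_LiminfD by (auto simp: eventually_nhds_conv_at)
qed

lemma measurable_phi [measurable]: "\<phi> \<in> borel_measurable borel"
proof (rule borel_measurableI_greater)
  fix c
  have "open {x. c < \<phi> x}"
    using eventually_greater by (subst open_subopen) (force simp: eventually_nhds)
  then show "{x \<in> space borel. c < \<phi> x} \<in> sets borel" by simp
qed

lemma open_superlevel_plus:
  assumes q: "continuous_on UNIV q"
  shows "open {x. c < \<phi> x + ereal (q x)}"
proof (cases c)
  case (real r)
  have "\<forall>\<^sub>F y in nhds x. c < \<phi> y + ereal (q y)" if "c < \<phi> x + ereal (q x)" for x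
  proof -
    have "ereal (r - q x) < \<phi> x" using that not_minf[of x] real by (cases "\<phi> x") auto
    then obtain s where s: "ereal (r - q x) < ereal s" "ereal s < \<phi> x"
      using ereal_dense2 by blast
    have "(q \<longlongrightarrow> q x) (nhds x)"
      using q by (metis UNIV_I continuous_on_def tendsto_at_iff_tendsto_nhds)
    then have "((\<lambda>y. r - q y) \<longlongrightarrow> r - q x) (nhds x)" by (intro tendsto_intros)
    then have "\<forall>\<^sub>F y in nhds x. r - q y < s" using s by (intro order_tendstoD(2)) auto
    moreover have "\<forall>\<^sub>F y in nhds x. ereal s < \<phi> y" using eventually_greater s by blast
    ultimately show ?thesis
    proof eventually_elim
      case (elim y)
      then show ?case using real not_minf[of y] by (cases "\<phi> y") auto
    qed
  qed
  then show ?thesis by (subst open_subopen) (force simp: eventually_nhds)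
next
  case MInf
  then have "{x. c < \<phi> x + ereal (q x)} = UNIV" using not_minf by auto
  then show ?thesis by simp
qed auto

text \<open>A convex function falls at most linearly: a far point x is drawn back along the segment
  to distance one from x0, where the minimum over the unit ball bounds \<phi> from below, and
  convexity transfers this bound to x. This takes the place of an affine minorant obtained by
  separation; linear decay is all that the quadratic in the proximal objective has to beat.\<close>

lemma norm_minorant:
  assumes x0: "x0 \<in> dom"
  shows "\<exists>a b. 0 \<le> b \<and> (\<forall>x. ereal (a - b * norm (x - x0)) \<le> \<phi> x)"
proof -
  have "open {x. c < \<phi> x}" for c
    using open_superlevel_plus[of "\<lambda>_. 0"] by (simp add: zero_ereal_def[symmetric])
  then obtain z where z: "z \<in> cball x0 1" "\<And>y. y \<in> cball x0 1 \<Longrightarrow> \<phi> z \<le> \<phi> y"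
    using lsc_attains_inf[of "cball x0 1" \<phi>] by auto
  have zd: "z \<in> dom" using z(2)[of x0] x0 by (auto simp: domain_of_def)
  have m: "\<phi>r z \<le> \<phi>r x0" using z(2)[of x0] dom_ereal[OF zd] dom_ereal[OF x0]
    by (metis centre_in_cball ereal_less_eq(3) zero_le_one)
  have "ereal (\<phi>r z - (\<phi>r x0 - \<phi>r z) * norm (x - x0)) \<le> \<phi> x" for x
  proof (cases "x \<in> dom")
    case xd: True
    let ?n = "norm (x - x0)"
    have "\<phi>r z - (\<phi>r x0 - \<phi>r z) * ?n \<le> \<phi>r x"
    proof (cases "?n \<le> 1")
      case True
      then have "\<phi> z \<le> \<phi> x" using z(2)[of x] by (simp add: dist_norm norm_minus_commute)
      then have "\<phi>r z \<le> \<phi>r x" using dom_ereal[OF zd] dom_ereal[OF xd] by (metis ereal_less_eq(3))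
      then show ?thesis using m by (smt (verit) mult_nonneg_nonneg norm_ge_zero)
    next
      case False
      let ?t = "1 / ?n"
      let ?y = "(1 - ?t) *\<^sub>R x0 + ?t *\<^sub>R x"
      have t: "0 \<le> ?t" "?t \<le> 1" using False by (auto simp: divide_le_eq_1)
      have "?y - x0 = ?t *\<^sub>R (x - x0)" by (simp add: algebra_simps)
      then have "norm (?y - x0) = 1" using False by (simp only: norm_scaleR) auto
      then have "?y \<in> cball x0 1" by (simp add: dist_norm norm_minus_commute)
      then have "\<phi> z \<le> \<phi> ?y" using z(2) by blast
      then have "\<phi>r z \<le> \<phi>r ?y"
        using dom_ereal[OF zd] dom_ereal[OF convex_dom(1)[OF x0 xd t]] by (metis ereal_less_eq(3))
      also have "\<dots> \<le> (1 - ?t) * \<phi>r x0 + ?t * \<phi>r x" by (rule convex_dom(2)[OF x0 xd t])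
      finally have "\<phi>r z * ?n \<le> ((1 - ?t) * \<phi>r x0 + ?t * \<phi>r x) * ?n"
        by (intro mult_right_mono) auto
      also have "\<dots> = ?n * \<phi>r x0 - \<phi>r x0 + \<phi>r x" using False by (simp add: field_simps)
      finally show ?thesis using m by (simp add: algebra_simps)
    qed
    then show ?thesis using dom_ereal[OF xd] by (metis ereal_less_eq(3))
  qed (simp add: not_dom)
  then show ?thesis using m by (intro exI[of _ "\<phi>r z"] exI[of _ "\<phi>r x0 - \<phi>r z"]) auto
qed

text \<open>\<open>prox\<close> is a choice by \<open>arg_min\<close>, so a minimizer has to be
  shown to exist before anything is known about it. Outside a large ball the quadratic outgrows the
  linear minorant, and inside it compactness and lower semicontinuity provide the minimizer.\<close>

lemma px_minimizer:
  assumes t: "0 < t"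
  shows "\<phi> (px t u) + ereal ((norm (u - px t u))\<^sup>2 / (2 * t)) \<le> \<phi> y + ereal ((norm (u - y))\<^sup>2 / (2 * t))"
proof -
  define g where "g y = \<phi> y + ereal ((norm (u - y))\<^sup>2 / (2 * t))" for y
  obtain x0 where x0: "x0 \<in> dom" using proper by (auto simp: proper_fun_def)
  obtain a b where ab: "0 \<le> b" "\<And>x. ereal (a - b * norm (x - x0)) \<le> \<phi> x"
    using norm_minorant[OF x0] by auto
  define d where "d = norm (u - x0)"
  define C where "C = \<phi>r x0 + d\<^sup>2 / (2 * t) - a + b * d"
  \<comment> \<open>Each entry has a task: d puts x0 into the ball, 2 t (b + 1) gives s^2 / (2 t)
    \<ge> (b + 1) s at any distance s > R, and C then turns the spare s into the excess over the
    value at x0.\<close>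
  define R where "R = max d (max (2 * t * (b + 1)) C)"
  have "R \<ge> 0" by (simp add: R_def d_def le_max_iff_disj)
  have "open {x. c < g x}" for c
    unfolding g_def by (intro open_superlevel_plus continuous_intros) (use t in auto)
  then obtain p where p: "p \<in> cball u R" "\<And>y. y \<in> cball u R \<Longrightarrow> g p \<le> g y"
    using lsc_attains_inf[of "cball u R" g] \<open>R \<ge> 0\<close> by auto
  have px0: "g p \<le> g x0" by (rule p) (auto simp: R_def d_def dist_norm)
  have g0: "g x0 = ereal (\<phi>r x0 + d\<^sup>2 / (2 * t))"
    unfolding g_def d_def using dom_ereal[OF x0] by (metis plus_ereal.simps(1))
  have "g p \<le> g y" for y
  proof (cases "y \<in> cball u R")
    case False
    let ?s = "norm (u - y)"
    have s: "R < ?s" using False by (simp add: dist_norm)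
    have "b + 1 \<le> ?s / (2 * t)" using s t by (simp add: R_def field_simps)
    then have "?s * (b + 1) \<le> ?s * (?s / (2 * t))" by (intro mult_left_mono) auto
    moreover have "?s \<ge> C" using s by (simp add: R_def)
    ultimately have 1: "C \<le> ?s\<^sup>2 / (2 * t) - b * ?s" by (simp add: power2_eq_square algebra_simps)
    have "norm (y - x0) \<le> ?s + d"
      unfolding d_def by (metis norm_minus_commute norm_triangle_sub add.commute diff_add_cancel
        norm_triangle_ineq add_diff_eq)
    then have "b * norm (y - x0) \<le> b * (?s + d)" using ab by (intro mult_left_mono)
    then have "\<phi>r x0 + d\<^sup>2 / (2 * t) \<le> (a - b * norm (y - x0)) + ?s\<^sup>2 / (2 * t)"
      using 1 unfolding C_def by (simp add: algebra_simps)
    then have "g x0 \<le> ereal (a - b * norm (y - x0)) + ereal (?s\<^sup>2 / (2 * t))" using g0 by simp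
    also have "\<dots> \<le> g y" unfolding g_def by (intro add_right_mono ab)
    finally show ?thesis using px0 by order
  qed (use p in auto)
  moreover have obj: "\<phi> y + ereal (1/2 * (norm_wrt (inverse t *\<^sub>R mat 1) (u - y))\<^sup>2) = g y" for y
    using t by (simp add: g_def norm_wrt_scaled_mat_1 mult.commute)
  ultimately have "is_arg_min (\<lambda>y. \<phi> y + ereal (1/2 * (norm_wrt (inverse t *\<^sub>R mat 1) (u - y))\<^sup>2))
      (\<lambda>_. True) p"
    by (simp add: is_arg_min_def leD)
  then have "is_arg_min (\<lambda>y. \<phi> y + ereal (1/2 * (norm_wrt (inverse t *\<^sub>R mat 1) (u - y))\<^sup>2))
      (\<lambda>_. True) (px t u)"
    unfolding px_def prox_def arg_min_def by (rule someI)
  then have "g (px t u) \<le> g y"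
    unfolding obj by (auto simp: is_arg_min_def not_less)
  then show ?thesis by (simp add: g_def)
qed

lemma px_dom:
  assumes t: "0 < t" shows "px t u \<in> dom"
proof -
  obtain x0 where x0: "x0 \<in> dom" using proper by (auto simp: proper_fun_def)
  have "\<phi> (px t u) + ereal ((norm (u - px t u))\<^sup>2 / (2 * t)) < \<infinity>"
    using x0 by (intro le_less_trans[OF px_minimizer[OF t, of u x0]]) (auto simp: domain_of_def)
  then show ?thesis by (auto simp: domain_of_def)
qed

text \<open>Compare the minimizer p with (1 - s) p + s y, divide by s and let s tend to 0: the
  square of y - p drops out. The result says that (u - p) / t is a subgradient of \<phi> at
  p.\<close>

lemma px_variational:
  assumes t: "0 < t" and y: "y \<in> dom"
  shows "\<phi>r (px t u) + (u - px t u) \<bullet> (y - px t u) / t \<le> \<phi>r y"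
proof -
  let ?p = "px t u"
  let ?c = "\<phi>r ?p + (u - ?p) \<bullet> (y - ?p) / t - \<phi>r y"
  let ?q = "(norm (y - ?p))\<^sup>2 / (2 * t)"
  have p: "?p \<in> dom" by (rule px_dom[OF t])
  have *: "?c \<le> s * ?q" if s: "0 < s" "s < 1" for s
  proof -
    let ?z = "(1 - s) *\<^sub>R ?p + s *\<^sub>R y"
    have z: "?z \<in> dom" "\<phi>r ?z \<le> (1 - s) * \<phi>r ?p + s * \<phi>r y"
      using convex_dom[OF p y, of s] s by auto
    have "\<phi>r ?p + (norm (u - ?p))\<^sup>2 / (2 * t) \<le> \<phi>r ?z + (norm (u - ?z))\<^sup>2 / (2 * t)"
      using px_minimizer[OF t, of u ?z] dom_ereal[OF p] dom_ereal[OF z(1)]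
      by (metis ereal_less_eq(3) plus_ereal.simps(1))
    moreover have "u - ?z = (u - ?p) + (- s) *\<^sub>R (y - ?p)" by (simp add: algebra_simps)
    then have "(norm (u - ?z))\<^sup>2 = (norm (u - ?p))\<^sup>2 - 2 * s * ((u - ?p) \<bullet> (y - ?p)) + s\<^sup>2 * (norm (y - ?p))\<^sup>2"
      by (simp only: norm_add_scaleR_sq) simp
    ultimately have "\<phi>r ?p + (norm (u - ?p))\<^sup>2 / (2 * t) \<le> \<phi>r ?z
        + ((norm (u - ?p))\<^sup>2 - 2 * s * ((u - ?p) \<bullet> (y - ?p)) + s\<^sup>2 * (norm (y - ?p))\<^sup>2) / (2 * t)"
      by simp
    also have "\<dots> = \<phi>r ?z + (norm (u - ?p))\<^sup>2 / (2 * t) - s * ((u - ?p) \<bullet> (y - ?p) / t) + s * (s * ?q)"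
      using t by (simp add: field_simps power2_eq_square)
    finally have "s * ?c \<le> s * (s * ?q)"
      using z(2) by (simp add: algebra_simps)
    then show ?thesis using s by (simp only: mult_le_cancel_left_pos)
  qed
  have "((\<lambda>s. s * ?q) \<longlongrightarrow> 0 * ?q) (at_right 0)" by (intro tendsto_intros)
  moreover have "\<forall>\<^sub>F s in at_right (0::real). ?c \<le> s * ?q"
    using * eventually_at_right_real[of 0 1] by (auto elim!: eventually_mono)
  ultimately have "?c \<le> 0 * ?q" by (rule tendsto_lowerbound) simp
  then show ?thesis by simp
qed

text \<open>Each proximal point is tested with the other; adding the two variational inequalities
  cancels \<phi> and leaves firm nonexpansiveness, from which Cauchy-Schwarz gives the
  claim.\<close>

lemma px_nonexpansive:
  assumes t: "0 < t"
  shows "norm (px t u - px t v) \<le> norm (u - v)"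
proof -
  let ?p = "px t u" and ?q = "px t v"
  have "((u - ?p) \<bullet> (?q - ?p) + (v - ?q) \<bullet> (?p - ?q)) / t \<le> 0"
    using px_variational[OF t px_dom[OF t, of v], of u] px_variational[OF t px_dom[OF t, of u], of v]
    by (simp add: add_divide_distrib)
  then have "(u - ?p) \<bullet> (?q - ?p) + (v - ?q) \<bullet> (?p - ?q) \<le> 0"
    using t by (simp add: divide_le_0_iff)
  then have "(norm (?p - ?q))\<^sup>2 \<le> (u - v) \<bullet> (?p - ?q)"
    by (simp add: power2_norm_eq_inner inner_simps inner_commute algebra_simps)
  also have "\<dots> \<le> norm (u - v) * norm (?p - ?q)" by (rule norm_cauchy_schwarz)
  finally show ?thesis
    by (cases "?p = ?q") (simp_all add: power2_eq_square mult_le_cancel_right)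
qed

lemma continuous_px: "0 < t \<Longrightarrow> continuous_on S (px t)"
  by (rule lipschitz_on_continuous_on[where L = 1]) (simp add: lipschitz_on_def dist_norm px_nonexpansive)

lemma measurable_px [measurable (raw)]:
  "0 < t \<Longrightarrow> g \<in> borel_measurable N \<Longrightarrow> (\<lambda>\<omega>. px t (g \<omega>)) \<in> borel_measurable N"
  using borel_measurable_continuous_onI[OF continuous_px] by (rule measurable_compose[rotated])

text \<open>With F and G the residuals for the parameters t and 1, the sum of the two variational
  inequalities becomes (|F| - t |G|) (|F| - |G|) \<le> 0, so |F| lies between t |G| and |G|. The
  lower end is what converts estimates at the step size of the method into estimates of the natural
  residual.\<close>

lemma residual_scaling:
  assumes t: "0 < t" "t \<le> 1"
  shows "t * norm (x - px 1 (x - v)) \<le> norm (x - px t (x - t *\<^sub>R v))"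
proof -
  let ?p = "px t (x - t *\<^sub>R v)" and ?q = "px 1 (x - v)"
  let ?F = "x - ?p" and ?G = "x - ?q"
  have 1: "\<phi>r ?p + (x - t *\<^sub>R v - ?p) \<bullet> (?q - ?p) / t \<le> \<phi>r ?q"
    by (rule px_variational) (use t px_dom in auto)
  have "\<phi>r ?q + (x - v - ?q) \<bullet> (?p - ?q) / 1 \<le> \<phi>r ?p"
    by (rule px_variational) (use t px_dom in auto)
  with 1 have "(x - t *\<^sub>R v - ?p) \<bullet> (?q - ?p) / t + (x - v - ?q) \<bullet> (?p - ?q) \<le> 0"
    by simp
  then have "t * ((x - t *\<^sub>R v - ?p) \<bullet> (?q - ?p) / t + (x - v - ?q) \<bullet> (?p - ?q)) \<le> 0"
    using t by (simp add: mult_le_0_iff)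
  then have "(x - t *\<^sub>R v - ?p) \<bullet> (?q - ?p) + t * ((x - v - ?q) \<bullet> (?p - ?q)) \<le> 0"
    using t by (simp add: distrib_left)
  moreover have "(x - t *\<^sub>R v - ?p) \<bullet> (?q - ?p) + t * ((x - v - ?q) \<bullet> (?p - ?q))
      = (?F - t *\<^sub>R ?G) \<bullet> (?F - ?G)"
    by (simp add: inner_simps algebra_simps)
  ultimately have "(norm ?F)\<^sup>2 + t * (norm ?G)\<^sup>2 \<le> (1 + t) * (?F \<bullet> ?G)"
    by (simp add: power2_norm_eq_inner inner_simps inner_commute algebra_simps)
  also have "\<dots> \<le> (1 + t) * (norm ?F * norm ?G)"
    using t by (intro mult_left_mono norm_cauchy_schwarz) auto
  finally have "(norm ?F - t * norm ?G) * (norm ?F - norm ?G) \<le> 0"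
    by (simp add: power2_eq_square algebra_simps)
  moreover have "t * norm ?G \<le> norm ?G" using t by (simp add: mult_left_le_one_le)
  ultimately show ?thesis
    by (smt (verit) mult_neg_neg)
qed

lemma residual_at_scaled_mat_1:
  "0 < t \<Longrightarrow> residual_at (inverse t *\<^sub>R mat 1) \<phi> v x = x - px t (x - t *\<^sub>R v)"
  by (simp add: residual_at_def px_def matrix_inv_scaled_mat_1)

lemma residual_mat_1: "residual (mat 1) f \<phi> x = x - px 1 (x - grad f x)"
  using residual_at_scaled_mat_1[of 1 "grad f x" x] by (simp add: residual_def)

end

section \<open>Gradients and the quadratic upper bound\<close>

lemma cont_diff_has_derivative:
  assumes "cont_diff f"
  shows "(f has_derivative (\<lambda>h. grad f x \<bullet> h)) (at x)"
proof -
  obtain f' where f': "(f has_derivative f') (at x)"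
    using assms by (auto simp: cont_diff_def differentiable_def)
  then have "linear f'" by (simp add: has_derivative_linear)
  \<comment> \<open>The adjoint of a linear functional, applied to 1, is its Riesz representative;
    uniqueness of derivatives then makes the description in \<open>grad\<close> denote this
    vector.\<close>
  then have "f' = (\<lambda>h. h \<bullet> adjoint f' 1)"
    by (simp add: fun_eq_iff adjoint_works)
  then have g: "GDERIV f x :> adjoint f' 1" using f' by (simp add: gderiv_def)
  have "grad f x = adjoint f' 1"
    unfolding grad_def
  proof (rule the_equality[where P = "\<lambda>D. GDERIV f x :> D", OF g])
    fix D assume "GDERIV f x :> D"
    then have "(\<lambda>h. h \<bullet> D) = (\<lambda>h. h \<bullet> adjoint f' 1)"
      using g unfolding gderiv_def by (rule has_derivative_unique)
    then show "D = adjoint f' 1" by (simp add: fun_eq_iff vector_eq_ldot)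
  qed
  then show ?thesis using g by (simp add: gderiv_def inner_commute)
qed

lemma descent_inequality:
  fixes f :: "real^'n \<Rightarrow> real"
  assumes f: "cont_diff f" and L: "L-lipschitz_on UNIV (grad f)"
  shows "f y \<le> f x + grad f x \<bullet> (y - x) + L / 2 * (norm (y - x))\<^sup>2"
proof -
  let ?d = "y - x"
  \<comment> \<open>The claim is h 1 \<le> h 0. Subtracting the quadratic inside h makes its
    derivative nonpositive by the Lipschitz bound, so monotonicity replaces an integral along the
    segment.\<close>
  define h where "h s = f (x + s *\<^sub>R ?d) - s * (grad f x \<bullet> ?d) - s\<^sup>2 * (L / 2 * (norm ?d)\<^sup>2)" for s
  have der: "(h has_real_derivative
      ((grad f (x + s *\<^sub>R ?d) - grad f x) \<bullet> ?d - s * L * (norm ?d)\<^sup>2)) (at s)" for s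
  proof -
    have "((\<lambda>s. f (x + s *\<^sub>R ?d)) has_derivative (\<lambda>r. grad f (x + s *\<^sub>R ?d) \<bullet> (r *\<^sub>R ?d))) (at s)"
      by (rule has_derivative_compose[OF _ cont_diff_has_derivative[OF f]])
         (auto intro!: derivative_eq_intros)
    then have 1: "((\<lambda>s. f (x + s *\<^sub>R ?d)) has_real_derivative grad f (x + s *\<^sub>R ?d) \<bullet> ?d) (at s)"
      by (simp add: has_field_derivative_def mult_commute_abs)
    have 2: "((\<lambda>s. s * c) has_real_derivative c) (at s)"
      and 3: "((\<lambda>s. s\<^sup>2 * c) has_real_derivative 2 * s * c) (at s)" for c
      by (auto intro!: derivative_eq_intros)
    show ?thesis
      unfolding h_def using DERIV_diff[OF DERIV_diff[OF 1 2[of "grad f x \<bullet> ?d"]] 3[of "L / 2 * (norm ?d)\<^sup>2"]]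
      by (simp add: inner_diff_left mult.assoc)
  qed
  have "h 1 \<le> h 0"
  proof (rule DERIV_nonpos_imp_nonincreasing[of 0 1 h])
    fix s :: real assume s: "0 \<le> s" "s \<le> 1"
    have "(grad f (x + s *\<^sub>R ?d) - grad f x) \<bullet> ?d \<le> norm (grad f (x + s *\<^sub>R ?d) - grad f x) * norm ?d"
      by (rule norm_cauchy_schwarz)
    also have "\<dots> \<le> (L * norm (s *\<^sub>R ?d)) * norm ?d"
      using lipschitz_onD[OF L, of "x + s *\<^sub>R ?d" x] by (intro mult_right_mono) (auto simp: dist_norm)
    also have "\<dots> = s * L * (norm ?d)\<^sup>2" using s by (simp add: power2_eq_square)
    finally show "\<exists>y. (h has_real_derivative y) (at s) \<and> y \<le> 0" using der[of s] by force
  qed simp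
  then show ?thesis by (simp add: h_def algebra_simps)
qed

context convex_lsc_proper
begin

text \<open>The points \<open>y\<close> and \<open>p\<close> are compared with their noise-free versions: since \<open>px\<close> is
  nonexpansive, replacing \<open>V\<close> and \<open>Vp\<close> by gradients costs only the squared errors and leaves
  inner products in which the second factor is predictable.\<close>

lemma extra_step_descent:
  fixes x V D Vp :: "real^'n"
  assumes f: "cont_diff f" and L: "L-lipschitz_on UNIV (grad f)" "1 \<le> L"
    and t: "0 < t" and s: "0 < s" "s \<le> 1 / L" and ab: "0 \<le> a" "0 \<le> b"
    and x: "x \<in> dom"
  defines "z \<equiv> x + b *\<^sub>R D"
    and "y \<equiv> px t (x - t *\<^sub>R V)"
    and "p \<equiv> px s (x + a *\<^sub>R D - s *\<^sub>R Vp)"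
  defines "e \<equiv> V - grad f x" and "e' \<equiv> grad f z - Vp"
  shows "f p + \<phi>r p \<le> f x + \<phi>r x
    + e \<bullet> (x - px t (x - t *\<^sub>R grad f x))
    + e' \<bullet> (px s (x + a *\<^sub>R D - s *\<^sub>R grad f z) - y)
    + ((a + L * b * s)\<^sup>2 * (norm D)\<^sup>2 / s + (norm (x - y))\<^sup>2 / (2 * s) - (norm (x - y))\<^sup>2 / t
       - (norm (p - y))\<^sup>2 / (4 * s) + t * (norm e)\<^sup>2 + s * (norm e')\<^sup>2)"
proof -
  let ?k = "a + L * b * s"
  define F where "F = x - y"
  define w where "w = p - y"
  define d where "d = p - x"
  have yd: "y \<in> dom" using px_dom t by (simp add: y_def)
  \<comment> \<open>The value of \<phi> at y is the bridge: \<open>F1\<close> tests p with y and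
    \<open>F2\<close> tests y with x, so it cancels in the sum.\<close>
  have F1: "\<phi>r p + (x + a *\<^sub>R D - s *\<^sub>R Vp - p) \<bullet> (y - p) / s \<le> \<phi>r y"
    unfolding p_def by (rule px_variational[OF s(1) yd])
  have F2: "\<phi>r y + (x - t *\<^sub>R V - y) \<bullet> (x - y) / t \<le> \<phi>r x"
    unfolding y_def by (rule px_variational[OF t x])
  have F3: "f p \<le> f x + grad f x \<bullet> d + L / 2 * (norm d)\<^sup>2"
    unfolding d_def by (rule descent_inequality[OF f L(1)])
  have "L / 2 \<le> 1 / (2 * s)" using s L by (simp add: field_simps)
  then have F4: "L / 2 * (norm d)\<^sup>2 \<le> (norm d)\<^sup>2 / (2 * s)"
    using mult_right_mono[of "L / 2" "1 / (2 * s)" "(norm d)\<^sup>2"] by simp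
  have E2: "(x - t *\<^sub>R V - y) \<bullet> (x - y) / t = (norm F)\<^sup>2 / t - V \<bullet> F"
    using t by (simp add: F_def power2_norm_eq_inner inner_simps field_simps)
  have dw: "d = w - F" by (simp add: d_def w_def F_def)
  have E1: "(x + a *\<^sub>R D - s *\<^sub>R Vp - p) \<bullet> (y - p) / s
      = ((d - a *\<^sub>R D) \<bullet> w) / s + Vp \<bullet> w"
    using s by (simp add: d_def w_def inner_simps field_simps)
  \<comment> \<open>In |d|^2 / 2 - <d, w> the mixed products of w and F cancel and (|F|^2 - |w|^2) /
    2 is left. Both squares in the final bound come from here.\<close>
  have E3: "(norm d)\<^sup>2 = (norm w)\<^sup>2 - 2 * (w \<bullet> F) + (norm F)\<^sup>2"
    unfolding dw by (simp add: power2_norm_eq_inner inner_simps inner_commute)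
  have E4: "d \<bullet> w = (norm w)\<^sup>2 - w \<bullet> F"
    unfolding dw by (simp add: power2_norm_eq_inner inner_simps inner_commute)
  have "f p + \<phi>r p \<le> f x + \<phi>r x + grad f x \<bullet> d + (norm d)\<^sup>2 / (2 * s)
      - (d \<bullet> w) / s + a * (D \<bullet> w) / s - Vp \<bullet> w - (norm F)\<^sup>2 / t + V \<bullet> F"
    using F1 F2 F3 F4 unfolding E1 E2 by (simp add: inner_simps diff_divide_distrib)
  also have "grad f x \<bullet> d = grad f x \<bullet> w - grad f x \<bullet> F" by (simp add: dw inner_simps)
  finally have main: "f p + \<phi>r p \<le> f x + \<phi>r x + e \<bullet> F + e' \<bullet> w
      + ((grad f x - grad f z) \<bullet> w + a * (D \<bullet> w) / s)
      - (norm w)\<^sup>2 / (2 * s) + (norm F)\<^sup>2 / (2 * s) - (norm F)\<^sup>2 / t"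
    unfolding e_def e'_def E3 E4
    by (simp add: inner_simps add_divide_distrib diff_divide_distrib)
  have "(grad f x - grad f z) \<bullet> w \<le> norm (grad f x - grad f z) * norm w"
    by (rule norm_cauchy_schwarz)
  also have "\<dots> \<le> (L * (b * norm D)) * norm w"
    using lipschitz_onD[OF L(1), of x z] ab by (intro mult_right_mono) (auto simp: dist_norm z_def)
  finally have "(grad f x - grad f z) \<bullet> w + a * (D \<bullet> w) / s
      \<le> L * b * norm D * norm w + a * (norm D * norm w) / s"
    using ab s by (intro add_mono divide_right_mono mult_left_mono norm_cauchy_schwarz) (auto simp: mult_ac)
  also have "\<dots> = ?k * norm D * norm w / s" using s by (simp add: field_simps)
  \<comment> \<open>Young's inequality with |w| / 2 as second factor spends |w|^2 / (4 s), half of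
    the available |w|^2 / (2 s); the other half survives and later controls the martingale
    \<open>b\<close>.\<close>
  also have "\<dots> \<le> (?k\<^sup>2 * (norm D)\<^sup>2 + (norm w)\<^sup>2 / 4) / s"
    using s sum_squares_bound[of "?k * norm D" "norm w / 2"]
    by (intro divide_right_mono) (auto simp: power_mult_distrib power_divide)
  also have "\<dots> = ?k\<^sup>2 * (norm D)\<^sup>2 / s + (norm w)\<^sup>2 / (4 * s)" by (simp add: add_divide_distrib)
  finally have Y: "(grad f x - grad f z) \<bullet> w + a * (D \<bullet> w) / s
      \<le> ?k\<^sup>2 * (norm D)\<^sup>2 / s + (norm w)\<^sup>2 / (4 * s)" .
  have "e \<bullet> F - e \<bullet> (x - px t (x - t *\<^sub>R grad f x)) = e \<bullet> (px t (x - t *\<^sub>R grad f x) - y)"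
    by (simp add: F_def inner_simps)
  also have "\<dots> \<le> norm e * norm (px t (x - t *\<^sub>R grad f x) - y)" by (rule norm_cauchy_schwarz)
  also have "\<dots> \<le> norm e * norm ((x - t *\<^sub>R grad f x) - (x - t *\<^sub>R V))"
    unfolding y_def by (intro mult_left_mono px_nonexpansive t) auto
  also have "(x - t *\<^sub>R grad f x) - (x - t *\<^sub>R V) = t *\<^sub>R e" by (simp add: e_def algebra_simps)
  finally have N1: "e \<bullet> F \<le> e \<bullet> (x - px t (x - t *\<^sub>R grad f x)) + t * (norm e)\<^sup>2"
    using t by (simp add: power2_eq_square algebra_simps)
  let ?q = "px s (x + a *\<^sub>R D - s *\<^sub>R grad f z)"
  have "e' \<bullet> w - e' \<bullet> (?q - y) = e' \<bullet> (p - ?q)"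
    by (simp add: w_def inner_simps)
  also have "\<dots> \<le> norm e' * norm (p - ?q)" by (rule norm_cauchy_schwarz)
  also have "\<dots> \<le> norm e' * norm ((x + a *\<^sub>R D - s *\<^sub>R Vp) - (x + a *\<^sub>R D - s *\<^sub>R grad f z))"
    unfolding p_def by (intro mult_left_mono px_nonexpansive s) auto
  also have "(x + a *\<^sub>R D - s *\<^sub>R Vp) - (x + a *\<^sub>R D - s *\<^sub>R grad f z) = s *\<^sub>R e'"
    by (simp add: e'_def algebra_simps)
  finally have N2: "e' \<bullet> w \<le> e' \<bullet> (?q - y) + s * (norm e')\<^sup>2"
    using s by (simp add: power2_eq_square algebra_simps)
  have "(norm w)\<^sup>2 / (2 * s) = (norm w)\<^sup>2 / (4 * s) + (norm w)\<^sup>2 / (4 * s)" by simp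
  then show ?thesis
    using main Y N1 N2 unfolding F_def w_def by linarith
qed

end

section \<open>Square-integrable martingale differences\<close>

text \<open>Measurability of f is listed separately because measurability of its squared norm does
  not imply it.\<close>

definition square_integrable :: "'a measure \<Rightarrow> ('a \<Rightarrow> 'b::{real_normed_vector,second_countable_topology}) \<Rightarrow> bool" where
  "square_integrable M f \<longleftrightarrow> f \<in> borel_measurable M \<and> integrable M (\<lambda>\<omega>. (norm (f \<omega>))\<^sup>2)"

lemma square_integrable_measurable: "square_integrable M f \<Longrightarrow> f \<in> borel_measurable M"
  and square_integrable_norm_sq: "square_integrable M f \<Longrightarrow> integrable M (\<lambda>\<omega>. (norm (f \<omega>))\<^sup>2)"
  by (simp_all add: square_integrable_def)

lemma square_integrable_bound:
  assumes "square_integrable M f" "g \<in> borel_measurable M" "\<And>\<omega>. \<omega> \<in> space M \<Longrightarrow> norm (g \<omega>) \<le> norm (f \<omega>)"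
  shows "square_integrable M g"
  unfolding square_integrable_def
proof (intro conjI assms(2) Bochner_Integration.integrable_bound[OF square_integrable_norm_sq[OF assms(1)]])
  have [measurable]: "g \<in> borel_measurable M" by fact
  show "(\<lambda>\<omega>. (norm (g \<omega>))\<^sup>2) \<in> borel_measurable M" by measurable
  show "AE \<omega> in M. norm ((norm (g \<omega>))\<^sup>2) \<le> norm ((norm (f \<omega>))\<^sup>2)"
    using assms(3) by (auto simp: power_mono)
qed

lemma square_integrable_norm:
  "square_integrable M f \<Longrightarrow> square_integrable M (\<lambda>\<omega>. norm (f \<omega>))"
  by (auto simp: square_integrable_def)

lemma norm_add_sq_le: "(norm (a + b))\<^sup>2 \<le> 2 * (norm a)\<^sup>2 + 2 * (norm b)\<^sup>2"
proof -
  have "(norm (a + b))\<^sup>2 \<le> (norm a + norm b)\<^sup>2" by (intro power_mono norm_triangle_ineq) auto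
  then show ?thesis using sum_squares_bound[of "norm a" "norm b"] by (simp add: power2_sum)
qed

lemma square_integrable_add:
  assumes "square_integrable M f" "square_integrable M g"
  shows "square_integrable M (\<lambda>\<omega>. f \<omega> + g \<omega>)"
proof -
  have [measurable]: "f \<in> borel_measurable M" "g \<in> borel_measurable M"
    using assms by (auto simp: square_integrable_def)
  have "integrable M (\<lambda>\<omega>. 2 * (norm (f \<omega>))\<^sup>2 + 2 * (norm (g \<omega>))\<^sup>2)"
    using assms by (auto simp: square_integrable_def)
  then have "integrable M (\<lambda>\<omega>. (norm (f \<omega> + g \<omega>))\<^sup>2)"
    by (rule Bochner_Integration.integrable_bound)
       (auto intro!: AE_I2 norm_add_sq_le order_trans[OF _ abs_ge_self])
  then show ?thesis by (simp add: square_integrable_def)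
qed

lemma square_integrable_scaleR:
  assumes "square_integrable M f"
  shows "square_integrable M (\<lambda>\<omega>. c *\<^sub>R f \<omega>)"
  using assms by (auto simp: square_integrable_def power_mult_distrib)

lemma square_integrable_diff:
  assumes "square_integrable M f" "square_integrable M g"
  shows "square_integrable M (\<lambda>\<omega>. f \<omega> - g \<omega>)"
  using square_integrable_add[OF assms(1) square_integrable_scaleR[OF assms(2), of "-1"]] by simp

lemma square_integrable_cong:
  "(\<And>\<omega>. \<omega> \<in> space M \<Longrightarrow> f \<omega> = g \<omega>) \<Longrightarrow> square_integrable M f \<longleftrightarrow> square_integrable M g"
  unfolding square_integrable_def
  by (intro conj_cong measurable_cong Bochner_Integration.integrable_cong) auto

lemma integrable_mult_of_square_integrable:
  fixes f g :: "'a \<Rightarrow> real"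
  assumes "square_integrable M f" "square_integrable M g"
  shows "integrable M (\<lambda>\<omega>. f \<omega> * g \<omega>)"
proof -
  have [measurable]: "f \<in> borel_measurable M" "g \<in> borel_measurable M"
    using assms by (auto simp: square_integrable_def)
  have "integrable M (\<lambda>\<omega>. (f \<omega>)\<^sup>2 + (g \<omega>)\<^sup>2)"
    using assms by (auto simp: square_integrable_def)
  then show ?thesis
  proof (rule Bochner_Integration.integrable_bound)
    have "\<bar>a * b\<bar> \<le> a\<^sup>2 + b\<^sup>2" for a b :: real
    proof -
      have "2 * \<bar>a * b\<bar> \<le> a\<^sup>2 + b\<^sup>2"
        using sum_squares_bound[of "\<bar>a\<bar>" "\<bar>b\<bar>"] by (simp add: abs_mult mult.assoc)
      then show ?thesis using abs_ge_zero[of "a * b"] by linarith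
    qed
    then show "AE \<omega> in M. norm (f \<omega> * g \<omega>) \<le> norm ((f \<omega>)\<^sup>2 + (g \<omega>)\<^sup>2)"
      by (intro AE_I2) simp
  qed measurable
qed

context prob_space
begin

lemma square_integrable_const: "square_integrable M (\<lambda>_. c)"
  by (simp add: square_integrable_def)

text \<open>Applied to the proximal maps and to the gradient, through the linear growth bound |g x|
  \<le> C |x| + |g 0|.\<close>

lemma square_integrable_lipschitz_compose:
  fixes g :: "'b::{real_normed_vector,second_countable_topology} \<Rightarrow> 'c::{real_normed_vector,second_countable_topology}"
  assumes g: "C-lipschitz_on UNIV g" and f: "square_integrable M f"
  shows "square_integrable M (\<lambda>\<omega>. g (f \<omega>))"
proof (rule square_integrable_bound)
  have C: "0 \<le> C" using g lipschitz_on_nonneg by blast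
  show "square_integrable M (\<lambda>\<omega>. C *\<^sub>R norm (f \<omega>) + norm (g 0))"
    by (intro square_integrable_add square_integrable_scaleR square_integrable_norm f square_integrable_const)
  show "(\<lambda>\<omega>. g (f \<omega>)) \<in> borel_measurable M"
    using borel_measurable_continuous_onI[OF lipschitz_on_continuous_on[OF g]]
    by (rule measurable_compose[OF square_integrable_measurable[OF f]])
  show "norm (g (f \<omega>)) \<le> norm (C *\<^sub>R norm (f \<omega>) + norm (g 0))" for \<omega>
  proof -
    have "norm (g (f \<omega>) - g 0) \<le> C * norm (f \<omega>)"
      using lipschitz_onD[OF g, of "f \<omega>" 0] by (simp add: dist_norm)
    then show ?thesis using C norm_triangle_sub[of "g (f \<omega>)" "g 0"] by simp
  qed
qed

lemma square_integrable_imp_integrable_norm: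
  assumes "square_integrable M f"
  shows "integrable M (\<lambda>\<omega>. norm (f \<omega>))"
  using integrable_mult_of_square_integrable[OF square_integrable_norm[OF assms] square_integrable_const[of 1]]
  by simp

lemma square_integrable_imp_integrable':
  fixes f :: "'a \<Rightarrow> 'b::{banach,second_countable_topology}"
  assumes "square_integrable M f"
  shows "integrable M f"
  using square_integrable_imp_integrable_norm[OF assms] assms
  by (simp add: integrable_norm_iff square_integrable_def)

end

lemma sq_integral_le_integral_sq:
  fixes f :: "'a \<Rightarrow> real"
  assumes "prob_space M" "square_integrable M f"
  shows "(\<integral>\<omega>. f \<omega> \<partial>M)\<^sup>2 \<le> (\<integral>\<omega>. (f \<omega>)\<^sup>2 \<partial>M)"
proof -
  interpret prob_space M by fact
  have "variance f = (\<integral>\<omega>. (f \<omega>)\<^sup>2 \<partial>M) - (\<integral>\<omega>. f \<omega> \<partial>M)\<^sup>2"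
    using variance_eq[OF square_integrable_imp_integrable'[OF assms(2)]]
      square_integrable_norm_sq[OF assms(2)] by simp
  then show ?thesis using variance_positive[of f] by linarith
qed

text \<open>The martingale property is stated as orthogonality to the square integrable functions of
  the past. This is the form used in Pythagoras' identity, and it passes directly to differences
  multiplied by a bounded predictable factor, as stopping requires. The difference with index k
  becomes known at time \<open>Suc k\<close>, so that \<open>S n\<close> is known at time n.\<close>

locale L2_martingale_differences = prob_space M
  for M :: "'a measure" and G :: "nat \<Rightarrow> 'a measure" and m :: "nat \<Rightarrow> 'a \<Rightarrow> real" +
  assumes subalg: "\<And>k. subalgebra M (G k)"
    and mono: "\<And>k. sets (G k) \<subseteq> sets (G (Suc k))"
    and adapted: "\<And>k. m k \<in> borel_measurable (G (Suc k))"
    and sq: "\<And>k. square_integrable M (m k)"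
    and orth: "\<And>k g. g \<in> borel_measurable (G k) \<Longrightarrow> square_integrable M g \<Longrightarrow>
      (\<integral>\<omega>. m k \<omega> * g \<omega> \<partial>M) = 0"
begin

abbreviation S :: "nat \<Rightarrow> 'a \<Rightarrow> real" where "S n \<omega> \<equiv> \<Sum>j<n. m j \<omega>"

lemma adapted_mono: "j \<le> n \<Longrightarrow> g \<in> borel_measurable (G j) \<Longrightarrow> g \<in> borel_measurable (G n)"
proof (induction rule: dec_induct)
  case (step n)
  have "subalgebra (G (Suc n)) (G n)" using subalg mono by (simp add: subalgebra_def)
  then show ?case by (rule measurable_from_subalg) (use step in auto)
qed simp

lemma S_adapted: "j \<le> n \<Longrightarrow> S j \<in> borel_measurable (G n)"
  by (intro borel_measurable_sum adapted_mono[OF _ adapted]) auto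

lemma S_sq: "square_integrable M (S n)"
  by (induction n) (simp_all add: square_integrable_const square_integrable_add sq)

lemma integral_m: "(\<integral>\<omega>. m k \<omega> \<partial>M) = 0"
  using orth[of "\<lambda>_. 1" k] by (simp add: square_integrable_const)

lemma integral_S: "(\<integral>\<omega>. S n \<omega> \<partial>M) = 0"
  using square_integrable_imp_integrable'[OF sq] by (simp add: integral_m)

lemma integral_S_sq: "(\<integral>\<omega>. (S n \<omega>)\<^sup>2 \<partial>M) = (\<Sum>j<n. \<integral>\<omega>. (m j \<omega>)\<^sup>2 \<partial>M)"
proof (induction n)
  case (Suc n)
  have i: "integrable M (\<lambda>\<omega>. (S n \<omega>)\<^sup>2)" "integrable M (\<lambda>\<omega>. (m n \<omega>)\<^sup>2)"
      "integrable M (\<lambda>\<omega>. m n \<omega> * S n \<omega>)"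
    using square_integrable_norm_sq[OF S_sq[of n]] square_integrable_norm_sq[OF sq[of n]]
      integrable_mult_of_square_integrable[OF sq S_sq] by simp_all
  have "(S (Suc n) \<omega>)\<^sup>2 = (S n \<omega>)\<^sup>2 + 2 * (m n \<omega> * S n \<omega>) + (m n \<omega>)\<^sup>2" for \<omega>
    by (simp add: power2_sum)
  then have "(\<integral>\<omega>. (S (Suc n) \<omega>)\<^sup>2 \<partial>M)
      = (\<integral>\<omega>. (S n \<omega>)\<^sup>2 \<partial>M) + 2 * (\<integral>\<omega>. m n \<omega> * S n \<omega> \<partial>M) + (\<integral>\<omega>. (m n \<omega>)\<^sup>2 \<partial>M)"
    using i by simp
  then show ?case using Suc orth[OF S_adapted[OF order_refl] S_sq] by simp
qed simp

lemma S_measurable [measurable]: "S n \<in> borel_measurable M"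
  by (rule square_integrable_measurable[OF S_sq])

text \<open>Kolmogorov's inequality, by applying Chebyshev to the process stopped when it leaves
  \<open>(-\<epsilon>, \<epsilon>)\<close>.\<close>

lemma maximal_inequality:
  assumes \<epsilon>: "0 < \<epsilon>"
  shows "prob {\<omega> \<in> space M. \<exists>j\<le>n. \<epsilon> \<le> \<bar>S j \<omega>\<bar>} \<le> (\<Sum>j<n. \<integral>\<omega>. (m j \<omega>)\<^sup>2 \<partial>M) / \<epsilon>\<^sup>2"
proof -
  \<comment> \<open>\<open>c j\<close> indicates that the partial sums have stayed inside the
    interval up to time j. It depends on the past of the difference with index j only, so
    \<open>m'\<close> is again a martingale difference sequence, with the stopped process as its
    partial sums.\<close>
  define c :: "nat \<Rightarrow> 'a \<Rightarrow> real" where "c j \<omega> = (if \<forall>i\<in>{..j}. \<bar>S i \<omega>\<bar> < \<epsilon> then 1 else 0)" for j \<omega>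
  define m' where "m' j \<omega> = m j \<omega> * c j \<omega>" for j \<omega>
  have c_meas: "c j \<in> borel_measurable (G j)" for j
  proof -
    have [measurable]: "S i \<in> borel_measurable (G j)" if "i \<in> {..j}" for i using S_adapted that by auto
    show ?thesis unfolding c_def by measurable
  qed
  have m_meas: "m j \<in> borel_measurable M" for j by (rule square_integrable_measurable[OF sq])
  have c_le: "\<bar>c j \<omega>\<bar> \<le> 1" for j \<omega> by (simp add: c_def)
  interpret stopped: L2_martingale_differences M G m'
  proof
    fix k
    show "m' k \<in> borel_measurable (G (Suc k))"
      unfolding m'_def using adapted adapted_mono[OF _ c_meas, of k "Suc k"] by simp
    show "square_integrable M (m' k)"
    proof (rule square_integrable_bound[OF sq])
      show "m' k \<in> borel_measurable M"
        unfolding m'_def using m_meas measurable_from_subalg[OF subalg c_meas] by simp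
      show "norm (m' k \<omega>) \<le> norm (m k \<omega>)" for \<omega>
        using c_le mult_left_le[of "\<bar>c k \<omega>\<bar>" "\<bar>m k \<omega>\<bar>"] by (simp add: m'_def abs_mult)
    qed
    fix g :: "'a \<Rightarrow> real" assume g: "g \<in> borel_measurable (G k)" "square_integrable M g"
    have "square_integrable M (\<lambda>\<omega>. c k \<omega> * g \<omega>)"
    proof (rule square_integrable_bound[OF g(2)])
      show "(\<lambda>\<omega>. c k \<omega> * g \<omega>) \<in> borel_measurable M"
        using measurable_from_subalg[OF subalg c_meas] measurable_from_subalg[OF subalg g(1)] by simp
      show "norm (c k \<omega> * g \<omega>) \<le> norm (g \<omega>)" for \<omega>
        using c_le mult_left_le_one_le[of "\<bar>g \<omega>\<bar>" "\<bar>c k \<omega>\<bar>"] by (simp add: abs_mult)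
    qed
    then show "(\<integral>\<omega>. m' k \<omega> * g \<omega> \<partial>M) = 0"
      using orth[of "\<lambda>\<omega>. c k \<omega> * g \<omega>" k] c_meas g by (simp add: m'_def mult.assoc)
  qed (use subalg mono in auto)
  have sub: "\<epsilon>\<^sup>2 \<le> (stopped.S n \<omega>)\<^sup>2" if ex: "\<exists>j\<le>n. \<epsilon> \<le> \<bar>S j \<omega>\<bar>" for \<omega>
  proof -
    define \<tau> where "\<tau> = (LEAST j. \<epsilon> \<le> \<bar>S j \<omega>\<bar>)"
    have \<tau>: "\<epsilon> \<le> \<bar>S \<tau> \<omega>\<bar>" unfolding \<tau>_def using ex by (metis (lifting) LeastI)
    have "\<tau> \<le> n" unfolding \<tau>_def using ex by (metis (lifting) Least_le order_trans)
    have small: "\<bar>S i \<omega>\<bar> < \<epsilon>" if "i < \<tau>" for i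
      using not_less_Least[OF that[unfolded \<tau>_def]] by simp
    \<comment> \<open>The difference with index j leads from \<open>S j\<close> to
      \<open>S (Suc j)\<close>; it is kept exactly while j lies before the exit time \<tau>, so the
      stopped sum freezes at the value reached at \<tau>.\<close>
    have "c j \<omega> = (if j < \<tau> then 1 else 0)" for j
      using small \<tau> by (force simp: c_def not_less)
    then have "stopped.S n \<omega> = (\<Sum>j<n. if j < \<tau> then m j \<omega> else 0)"
      by (intro sum.cong) (auto simp: m'_def)
    also have "\<dots> = S \<tau> \<omega>"
      using \<open>\<tau> \<le> n\<close> by (intro sum.mono_neutral_cong_right) auto
    finally show ?thesis using \<tau> \<epsilon> power_mono[OF \<tau>, of 2] by simp
  qed
  have "prob {\<omega> \<in> space M. \<exists>j\<le>n. \<epsilon> \<le> \<bar>S j \<omega>\<bar>} \<le> prob {\<omega> \<in> space M. \<epsilon>\<^sup>2 \<le> (stopped.S n \<omega>)\<^sup>2}"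
    using sub by (intro finite_measure_mono) auto
  also have "\<dots> \<le> (\<integral>\<omega>. (stopped.S n \<omega>)\<^sup>2 \<partial>M) / \<epsilon>\<^sup>2"
    using \<epsilon> square_integrable_norm_sq[OF stopped.S_sq[of n]]
    by (intro integral_Markov_inequality_measure[where A = "{}"]) auto
  also have "\<dots> \<le> (\<Sum>j<n. \<integral>\<omega>. (m j \<omega>)\<^sup>2 \<partial>M) / \<epsilon>\<^sup>2"
    unfolding stopped.integral_S_sq
  proof (intro divide_right_mono sum_mono integral_mono)
    fix j \<omega>
    show "(m' j \<omega>)\<^sup>2 \<le> (m j \<omega>)\<^sup>2" by (simp add: m'_def c_def)
    show "integrable M (\<lambda>\<omega>. (m' j \<omega>)\<^sup>2)" "integrable M (\<lambda>\<omega>. (m j \<omega>)\<^sup>2)"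
      using square_integrable_norm_sq[OF stopped.sq[of j]] square_integrable_norm_sq[OF sq[of j]] by simp_all
  qed (use \<epsilon> in auto)
  finally show ?thesis .
qed

lemma shift: "L2_martingale_differences M (\<lambda>k. G (N + k)) (\<lambda>k. m (N + k))"
  by unfold_locales (use subalg mono adapted sq orth in auto)

lemma S_shift: "(\<Sum>j<n. m (N + j) \<omega>) = S (N + n) \<omega> - S N \<omega>"
  by (induction n) simp_all

context
  assumes summable_sq: "summable (\<lambda>k. \<integral>\<omega>. (m k \<omega>)\<^sup>2 \<partial>M)"
begin

abbreviation (input) tail :: "nat \<Rightarrow> real" where
  "tail N \<equiv> (\<Sum>k. \<integral>\<omega>. (m k \<omega>)\<^sup>2 \<partial>M) - (\<Sum>k<N. \<integral>\<omega>. (m k \<omega>)\<^sup>2 \<partial>M)"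

lemma tail_tendsto: "tail \<longlonglongrightarrow> 0"
proof -
  have "tail \<longlonglongrightarrow> (\<Sum>k. \<integral>\<omega>. (m k \<omega>)\<^sup>2 \<partial>M) - (\<Sum>k. \<integral>\<omega>. (m k \<omega>)\<^sup>2 \<partial>M)"
    by (intro tendsto_intros summable_LIMSEQ summable_sq)
  then show ?thesis by simp
qed

lemma partial_le_tail: "(\<Sum>j<n. \<integral>\<omega>. (m (N + j) \<omega>)\<^sup>2 \<partial>M) \<le> tail N"
proof -
  have "(\<Sum>j<n. \<integral>\<omega>. (m (N + j) \<omega>)\<^sup>2 \<partial>M)
      = (\<Sum>j<N + n. \<integral>\<omega>. (m j \<omega>)\<^sup>2 \<partial>M) - (\<Sum>j<N. \<integral>\<omega>. (m j \<omega>)\<^sup>2 \<partial>M)"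
    by (induction n) simp_all
  moreover have "(\<Sum>j<N + n. \<integral>\<omega>. (m j \<omega>)\<^sup>2 \<partial>M) \<le> (\<Sum>k. \<integral>\<omega>. (m k \<omega>)\<^sup>2 \<partial>M)"
    by (rule sum_le_suminf[OF summable_sq]) auto
  ultimately show ?thesis by simp
qed

text \<open>The maximal inequality for the process restarted at N has a bound independent of the
  horizon, so continuity from below removes the horizon.\<close>

lemma prob_oscillation:
  assumes \<epsilon>: "0 < \<epsilon>"
  shows "prob {\<omega> \<in> space M. \<exists>j. \<epsilon> \<le> \<bar>S (N + j) \<omega> - S N \<omega>\<bar>} \<le> tail N / \<epsilon>\<^sup>2"
proof -
  interpret sh: L2_martingale_differences M "\<lambda>k. G (N + k)" "\<lambda>k. m (N + k)" by (rule shift)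
  let ?A = "\<lambda>n. {\<omega> \<in> space M. \<exists>j\<le>n. \<epsilon> \<le> \<bar>S (N + j) \<omega> - S N \<omega>\<bar>}"
  have "prob (?A n) \<le> tail N / \<epsilon>\<^sup>2" for n
    using order_trans[OF sh.maximal_inequality[OF \<epsilon>, of n, unfolded S_shift]
        divide_right_mono[OF partial_le_tail]] by simp
  moreover have "(\<lambda>n. prob (?A n)) \<longlonglongrightarrow> prob (\<Union>n. ?A n)"
    by (rule finite_Lim_measure_incseq) (auto simp: incseq_def intro: order_trans)
  ultimately have "prob (\<Union>n. ?A n) \<le> tail N / \<epsilon>\<^sup>2"
    by (intro LIMSEQ_le_const2) auto
  moreover have "(\<Union>n. ?A n) = {\<omega> \<in> space M. \<exists>j. \<epsilon> \<le> \<bar>S (N + j) \<omega> - S N \<omega>\<bar>}" by auto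
  ultimately show ?thesis by simp
qed

text \<open>Oscillating by \<epsilon> after every N has probability at most \<open>tail N\<close> /
  \<epsilon>^2 for each N, hence probability 0. Running through countably many \<epsilon> gives the
  Cauchy property almost surely.\<close>

lemma AE_convergent: "AE \<omega> in M. convergent (\<lambda>n. S n \<omega>)"
proof -
  have "AE \<omega> in M. \<exists>N. \<forall>j. \<bar>S (N + j) \<omega> - S N \<omega>\<bar> < inverse (real (Suc q))" for q
  proof -
    let ?\<epsilon> = "inverse (real (Suc q))"
    let ?B = "{\<omega> \<in> space M. \<forall>N. \<exists>j. ?\<epsilon> \<le> \<bar>S (N + j) \<omega> - S N \<omega>\<bar>}"
    have B: "?B \<in> sets M" by measurable
    have "prob ?B \<le> tail N / ?\<epsilon>\<^sup>2" for N
      by (rule order_trans[OF finite_measure_mono prob_oscillation]) auto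
    moreover have "(\<lambda>N. tail N / ?\<epsilon>\<^sup>2) \<longlonglongrightarrow> 0 / ?\<epsilon>\<^sup>2"
      by (intro tendsto_intros tail_tendsto) simp
    ultimately have "prob ?B \<le> 0 / ?\<epsilon>\<^sup>2"
      using LIMSEQ_le_const[of "\<lambda>N. tail N / ?\<epsilon>\<^sup>2"] by blast
    then have "prob ?B \<le> 0" by simp
    then have "?B \<in> null_sets M" using B by (simp add: null_sets_def emeasure_eq_measure measure_le_0_iff)
    then have "AE \<omega> in M. \<omega> \<notin> ?B" by (rule AE_not_in)
    with AE_space show ?thesis by eventually_elim (auto simp: not_le)
  qed
  then have "AE \<omega> in M. \<forall>q. \<exists>N. \<forall>j. \<bar>S (N + j) \<omega> - S N \<omega>\<bar> < inverse (real (Suc q))"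
    by (simp add: AE_all_countable)
  then show ?thesis
  proof eventually_elim
    case (elim \<omega>)
    have "Cauchy (\<lambda>n. S n \<omega>)"
    proof (rule metric_CauchyI)
      fix e :: real assume "0 < e"
      then obtain q where q: "inverse (real (Suc q)) < e / 2" using reals_Archimedean[of "e / 2"] by auto
      obtain N where N: "\<And>j. \<bar>S (N + j) \<omega> - S N \<omega>\<bar> < inverse (real (Suc q))" using elim by blast
      have "dist (S i \<omega>) (S j \<omega>) < e" if "N \<le> i" "N \<le> j" for i j
        using N[of "i - N"] N[of "j - N"] that q by (simp add: dist_real_def)
      then show "\<exists>N. \<forall>i\<ge>N. \<forall>j\<ge>N. dist (S i \<omega>) (S j \<omega>) < e" by blast
    qed
    then show ?case by (simp add: Cauchy_convergent)
  qed
qed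

text \<open>Fatou's lemma turns the uniform bound on the increments after n into E (T - S n)^2 \<le>
  \<open>tail n\<close>. This makes T integrable, and since E S n = 0, it bounds (E T)^2 by every
  \<open>tail n\<close>, so the limit inherits mean zero.\<close>

lemma L2_limit:
  "\<exists>T. integrable M T \<and> (\<integral>\<omega>. T \<omega> \<partial>M) = 0 \<and> (AE \<omega> in M. (\<lambda>n. S n \<omega>) \<longlonglongrightarrow> T \<omega>)"
proof -
  define T where "T \<omega> = lim (\<lambda>n. S n \<omega>)" for \<omega>
  have T: "AE \<omega> in M. (\<lambda>n. S n \<omega>) \<longlonglongrightarrow> T \<omega>"
    using AE_convergent by eventually_elim (simp add: T_def convergent_LIMSEQ_iff)
  have [measurable]: "T \<in> borel_measurable M" unfolding T_def by measurable
  have dist_le: "(\<integral>\<^sup>+\<omega>. ennreal ((T \<omega> - S n \<omega>)\<^sup>2) \<partial>M) \<le> ennreal (tail n)" for n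
  proof -
    interpret sh: L2_martingale_differences M "\<lambda>k. G (n + k)" "\<lambda>k. m (n + k)" by (rule shift)
    have "AE \<omega> in M. ennreal ((T \<omega> - S n \<omega>)\<^sup>2) = liminf (\<lambda>k. ennreal ((S (n + k) \<omega> - S n \<omega>)\<^sup>2))"
      using T
    proof eventually_elim
      case (elim \<omega>)
      then have "(\<lambda>k. S (n + k) \<omega>) \<longlonglongrightarrow> T \<omega>"
        using LIMSEQ_ignore_initial_segment[of _ _ n] by (simp add: add.commute)
      then have "(\<lambda>k. ennreal ((S (n + k) \<omega> - S n \<omega>)\<^sup>2)) \<longlonglongrightarrow> ennreal ((T \<omega> - S n \<omega>)\<^sup>2)"
        by (intro tendsto_intros)
      then show ?case by (rule lim_imp_Liminf[OF sequentially_bot, symmetric])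
    qed
    then have "(\<integral>\<^sup>+\<omega>. ennreal ((T \<omega> - S n \<omega>)\<^sup>2) \<partial>M)
        = (\<integral>\<^sup>+\<omega>. liminf (\<lambda>k. ennreal ((S (n + k) \<omega> - S n \<omega>)\<^sup>2)) \<partial>M)"
      by (rule nn_integral_cong_AE)
    also have "\<dots> \<le> liminf (\<lambda>k. \<integral>\<^sup>+\<omega>. ennreal ((S (n + k) \<omega> - S n \<omega>)\<^sup>2) \<partial>M)"
      by (intro nn_integral_liminf) measurable
    also have "\<dots> \<le> ennreal (tail n)"
    proof (rule Liminf_le)
      have "(\<integral>\<^sup>+\<omega>. ennreal ((S (n + k) \<omega> - S n \<omega>)\<^sup>2) \<partial>M) \<le> ennreal (tail n)" for k
      proof -
        have "(\<integral>\<^sup>+\<omega>. ennreal ((S (n + k) \<omega> - S n \<omega>)\<^sup>2) \<partial>M)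
            = ennreal (\<integral>\<omega>. (S (n + k) \<omega> - S n \<omega>)\<^sup>2 \<partial>M)"
          using square_integrable_norm_sq[OF sh.S_sq[of k, unfolded S_shift]]
          by (intro nn_integral_eq_integral) auto
        also have "\<dots> \<le> ennreal (tail n)"
          using sh.integral_S_sq[of k] partial_le_tail[of n k] by (intro ennreal_leI) (simp add: S_shift)
        finally show ?thesis .
      qed
      then show "\<forall>\<^sub>F k in sequentially. (\<integral>\<^sup>+\<omega>. ennreal ((S (n + k) \<omega> - S n \<omega>)\<^sup>2) \<partial>M) \<le> ennreal (tail n)"
        by simp
    qed simp
    finally show ?thesis .
  qed
  have sqT: "square_integrable M (\<lambda>\<omega>. T \<omega> - S n \<omega>)" for n
    using le_less_trans[OF dist_le[of n]]
    by (auto simp: square_integrable_def integrable_iff_bounded)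
  have iT: "integrable M T" using square_integrable_imp_integrable'[OF sqT[of 0]] by simp
  have "(\<integral>\<omega>. T \<omega> \<partial>M)\<^sup>2 \<le> tail n" for n
  proof -
    have "(\<integral>\<omega>. T \<omega> \<partial>M) = (\<integral>\<omega>. T \<omega> - S n \<omega> \<partial>M)"
      using iT square_integrable_imp_integrable'[OF S_sq[of n]] integral_S[of n] by simp
    also have "\<dots>\<^sup>2 \<le> (\<integral>\<omega>. (T \<omega> - S n \<omega>)\<^sup>2 \<partial>M)"
      by (rule sq_integral_le_integral_sq[OF prob_space_axioms sqT])
    also have "\<dots> \<le> tail n"
    proof -
      have "ennreal (\<integral>\<omega>. (T \<omega> - S n \<omega>)\<^sup>2 \<partial>M) \<le> ennreal (tail n)"
        using dist_le[of n] square_integrable_norm_sq[OF sqT[of n]]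
        by (subst nn_integral_eq_integral[symmetric]) auto
      then show ?thesis using partial_le_tail[of n 0] by (simp add: ennreal_le_iff)
    qed
    finally show ?thesis .
  qed
  then have "(\<integral>\<omega>. T \<omega> \<partial>M)\<^sup>2 \<le> 0" by (intro LIMSEQ_le_const[OF tail_tendsto]) auto
  then show ?thesis using T iT by auto
qed

end

end

lemma (in prob_space) perturbed_decreasing_convergence:
  fixes P s :: "nat \<Rightarrow> 'a \<Rightarrow> real"
  assumes P: "\<And>k. integrable M (P k)" "\<And>k. AE \<omega> in M. c \<le> P k \<omega>"
    and step: "\<And>k. AE \<omega> in M. P (Suc k) \<omega> \<le> P k \<omega> + s k \<omega>"
    and s: "\<And>k. integrable M (s k)"
    and S: "integrable M S" "AE \<omega> in M. (\<lambda>n. \<Sum>j<n. s j \<omega>) \<longlonglongrightarrow> S \<omega>"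
      "(\<lambda>n. \<Sum>j<n. \<integral>\<omega>. s j \<omega> \<partial>M) \<longlonglongrightarrow> (\<integral>\<omega>. S \<omega> \<partial>M)"
  shows "\<exists>Y. integrable M Y \<and> (AE \<omega> in M. (\<lambda>k. P k \<omega>) \<longlonglongrightarrow> Y \<omega>)
    \<and> (\<lambda>k. \<integral>\<omega>. P k \<omega> \<partial>M) \<longlonglongrightarrow> (\<integral>\<omega>. Y \<omega> \<partial>M)"
proof -
  \<comment> \<open>The sign is chosen so that U increases, as the monotone convergence theorems
    used below require.\<close>
  define U where "U k \<omega> = (\<Sum>j<k. s j \<omega>) - P k \<omega>" for k \<omega>
  have U: "integrable M (U k)" for k
    unfolding U_def by (intro Bochner_Integration.integrable_diff Bochner_Integration.integrable_sum P s)
  have AE_mono: "AE \<omega> in M. mono (\<lambda>k. U k \<omega>)"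
  proof -
    have "AE \<omega> in M. \<forall>k. P (Suc k) \<omega> \<le> P k \<omega> + s k \<omega>" using step by (simp add: AE_all_countable)
    then show ?thesis by eventually_elim (auto simp: U_def mono_iff_le_Suc algebra_simps)
  qed
  have AE_lower: "AE \<omega> in M. \<forall>k. c \<le> P k \<omega>" using P(2) by (simp add: AE_all_countable)
  have "AE \<omega> in M. convergent (\<lambda>k. U k \<omega>)"
    using AE_mono AE_lower S(2)
  proof eventually_elim
    case (elim \<omega>)
    from elim(3) have "Bseq (\<lambda>n. \<Sum>j<n. s j \<omega>)" by (intro convergent_imp_Bseq convergentI)
    then obtain K where K: "\<And>n. \<bar>\<Sum>j<n. s j \<omega>\<bar> \<le> K" unfolding Bseq_def by auto
    have "U k \<omega> \<le> K - c" for k unfolding U_def using abs_le_D1[OF K[of k]] elim(2) by (intro diff_mono) auto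
    then obtain L where "(\<lambda>k. U k \<omega>) \<longlonglongrightarrow> L"
      using incseq_convergent[of "\<lambda>k. U k \<omega>" "K - c"] elim(1) by metis
    then show ?case by (auto simp: convergent_def)
  qed
  then have lim: "AE \<omega> in M. (\<lambda>k. U k \<omega>) \<longlonglongrightarrow> lim (\<lambda>k. U k \<omega>)"
    by eventually_elim (simp add: convergent_LIMSEQ_iff)
  have [measurable]: "U k \<in> borel_measurable M" for k using U by auto
  let ?u = "\<lambda>k. \<integral>\<omega>. U k \<omega> \<partial>M"
  have u: "?u k = (\<Sum>j<k. \<integral>\<omega>. s j \<omega> \<partial>M) - (\<integral>\<omega>. P k \<omega> \<partial>M)" for k
    unfolding U_def using P s by simp
  \<comment> \<open>The bound found above depends on \<omega> and says nothing about means. The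
    means of U are bounded separately, from the convergence of the summed means of s.\<close>
  have "Bseq (\<lambda>n. \<Sum>j<n. \<integral>\<omega>. s j \<omega> \<partial>M)"
    using S(3) by (intro convergent_imp_Bseq convergentI)
  then obtain K where K: "\<And>n. \<bar>\<Sum>j<n. \<integral>\<omega>. s j \<omega> \<partial>M\<bar> \<le> K" unfolding Bseq_def by auto
  have "c \<le> (\<integral>\<omega>. P k \<omega> \<partial>M)" for k
    using integral_mono_AE[of M "\<lambda>_. c" "P k"] P by (simp add: prob_space)
  then have "?u k \<le> K - c" for k unfolding u using abs_le_D1[OF K[of k]] by (intro diff_mono) auto
  moreover have "incseq ?u"
    unfolding incseq_Suc_iff
  proof
    fix k
    show "?u k \<le> ?u (Suc k)"
      using AE_mono by (intro integral_mono_AE U) (auto elim!: eventually_mono simp: mono_iff_le_Suc)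
  qed
  ultimately obtain L where L: "?u \<longlonglongrightarrow> L"
    using incseq_convergent[of ?u "K - c"] by metis
  have UL: "integrable M (\<lambda>\<omega>. lim (\<lambda>k. U k \<omega>))" "(\<integral>\<omega>. lim (\<lambda>k. U k \<omega>) \<partial>M) = L"
    by (rule integrable_monotone_convergence[OF U AE_mono lim L]
        integral_monotone_convergence[OF U AE_mono lim L], measurable)+
  let ?Y = "\<lambda>\<omega>. S \<omega> - lim (\<lambda>k. U k \<omega>)"
  have "integrable M ?Y" using S UL by simp
  moreover have "AE \<omega> in M. (\<lambda>k. P k \<omega>) \<longlonglongrightarrow> ?Y \<omega>"
    using lim S(2)
  proof eventually_elim
    case (elim \<omega>)
    from tendsto_diff[OF elim(2,1)] show ?case by (simp add: U_def)
  qed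
  moreover have "(\<lambda>k. \<integral>\<omega>. P k \<omega> \<partial>M) \<longlonglongrightarrow> (\<integral>\<omega>. ?Y \<omega> \<partial>M)"
    using tendsto_diff[OF S(3) L] UL S(1) by (simp add: u)
  ultimately show ?thesis by blast
qed

section \<open>Conditional means and conditional second moments\<close>

lemma prob_space_sigma_finite_subalgebra:
  "prob_space M \<Longrightarrow> subalgebra M F \<Longrightarrow> sigma_finite_subalgebra M F"
  by (intro finite_measure_subalgebra_is_sigma_finite)
     (simp add: finite_measure_subalgebra_def finite_measure_subalgebra_axioms_def prob_space.axioms)

context
  fixes M F :: "'a measure"
  assumes prob: "prob_space M" and sub: "subalgebra M F"
begin

interpretation prob_space M by (rule prob)
interpretation sigma_finite_subalgebra M F by (rule prob_space_sigma_finite_subalgebra[OF prob sub])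

text \<open>The integrability condition concerns the product of the norms rather than h alone: in
  the application h is a scalar times a vector, both square integrable, so it is in general only
  integrable itself. The proof runs by coordinates, as \<open>vec_cond_exp\<close> does.\<close>

lemma vec_cond_exp_orthogonal:
  fixes W g h :: "'a \<Rightarrow> real^'n"
  assumes W: "integrable M W" and g: "integrable M g" "g \<in> borel_measurable F"
    and mean: "AE \<omega> in M. vec_cond_exp M F W \<omega> = g \<omega>"
    and h: "h \<in> borel_measurable F"
    and int: "integrable M (\<lambda>\<omega>. norm (W \<omega> - g \<omega>) * norm (h \<omega>))"
  shows "(\<integral>\<omega>. (W \<omega> - g \<omega>) \<bullet> h \<omega> \<partial>M) = 0"
proof -
  have [measurable]: "W \<in> borel_measurable M" "g \<in> borel_measurable M" "h \<in> borel_measurable M"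
    using W g measurable_from_subalg[OF sub h] by auto
  have [measurable]: "(\<lambda>\<omega>. W \<omega> $ i) \<in> borel_measurable M" "(\<lambda>\<omega>. g \<omega> $ i) \<in> borel_measurable M"
      "(\<lambda>\<omega>. h \<omega> $ i) \<in> borel_measurable M" for i
    by (auto intro: measurable_compose[of W M borel] measurable_compose[of g M borel]
      measurable_compose[of h M borel])
  have nth: "integrable M (\<lambda>\<omega>. u \<omega> $ i)" if "integrable M u" for u :: "'a \<Rightarrow> real^'n" and i
    using integrable_inner_left[of "axis i 1" M u] that by (simp add: inner_axis)
  have gi: "(\<lambda>\<omega>. g \<omega> $ i) \<in> borel_measurable F" and hi: "(\<lambda>\<omega>. h \<omega> $ i) \<in> borel_measurable F" for i
    by (auto intro: measurable_compose[OF g(2)] measurable_compose[OF h])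
  have int_i: "integrable M (\<lambda>\<omega>. h \<omega> $ i * (W \<omega> $ i - g \<omega> $ i))" for i
  proof (rule Bochner_Integration.integrable_bound[OF int])
    show "AE \<omega> in M. norm (h \<omega> $ i * (W \<omega> $ i - g \<omega> $ i)) \<le> norm (norm (W \<omega> - g \<omega>) * norm (h \<omega>))"
      using component_le_norm_cart[of "W _ - g _" i] component_le_norm_cart[of "h _" i]
      by (intro AE_I2) (auto simp: abs_mult mult.commute intro!: mult_mono)
  qed measurable
  have "(\<integral>\<omega>. h \<omega> $ i * (W \<omega> $ i - g \<omega> $ i) \<partial>M) = 0" for i
  proof -
    have "AE \<omega> in M. real_cond_exp M F (\<lambda>\<omega>. W \<omega> $ i - g \<omega> $ i) \<omega>
        = real_cond_exp M F (\<lambda>\<omega>. W \<omega> $ i) \<omega> - real_cond_exp M F (\<lambda>\<omega>. g \<omega> $ i) \<omega>"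
      by (intro real_cond_exp_diff nth W g)
    moreover have "AE \<omega> in M. real_cond_exp M F (\<lambda>\<omega>. g \<omega> $ i) \<omega> = g \<omega> $ i"
      by (intro real_cond_exp_F_meas nth g gi)
    ultimately have "AE \<omega> in M. h \<omega> $ i * real_cond_exp M F (\<lambda>\<omega>. W \<omega> $ i - g \<omega> $ i) \<omega> = 0"
      using mean by eventually_elim (auto simp: vec_cond_exp_def vec_eq_iff)
    then have "(\<integral>\<omega>. h \<omega> $ i * real_cond_exp M F (\<lambda>\<omega>. W \<omega> $ i - g \<omega> $ i) \<omega> \<partial>M) = 0"
      by (rule integral_eq_zero_AE)
    moreover have "(\<integral>\<omega>. h \<omega> $ i * real_cond_exp M F (\<lambda>\<omega>. W \<omega> $ i - g \<omega> $ i) \<omega> \<partial>M)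
        = (\<integral>\<omega>. h \<omega> $ i * (W \<omega> $ i - g \<omega> $ i) \<partial>M)"
      by (intro real_cond_exp_intg(2) int_i hi) measurable
    ultimately show ?thesis by simp
  qed
  then show ?thesis
    using int_i by (simp add: inner_vec_def mult.commute)
qed

lemma nn_integral_cond_sq_norm_le:
  fixes u v :: "'a \<Rightarrow> real^'n"
  assumes le: "AE \<omega> in M. cond_sq_norm M F u \<omega> \<le> c * cond_sq_norm M F v \<omega>"
    and [measurable]: "u \<in> borel_measurable M" "v \<in> borel_measurable M"
  shows "(\<integral>\<^sup>+\<omega>. ennreal ((norm (u \<omega>))\<^sup>2) \<partial>M) \<le> c * (\<integral>\<^sup>+\<omega>. ennreal ((norm (v \<omega>))\<^sup>2) \<partial>M)"
proof -
  have eq: "(\<integral>\<^sup>+\<omega>. cond_sq_norm M F w \<omega> \<partial>M) = (\<integral>\<^sup>+\<omega>. ennreal ((norm (w \<omega>))\<^sup>2) \<partial>M)"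
    if "w \<in> borel_measurable M" for w :: "'a \<Rightarrow> real^'n"
    using nn_cond_exp_intg[of "\<lambda>_. 1" "\<lambda>\<omega>. ennreal ((norm (w \<omega>))\<^sup>2)"] that by (simp add: cond_sq_norm_def)
  have "(\<integral>\<^sup>+\<omega>. cond_sq_norm M F u \<omega> \<partial>M) \<le> (\<integral>\<^sup>+\<omega>. c * cond_sq_norm M F v \<omega> \<partial>M)"
    by (intro nn_integral_mono_AE le)
  also have "\<dots> = c * (\<integral>\<^sup>+\<omega>. cond_sq_norm M F v \<omega> \<partial>M)"
    by (rule nn_integral_cmult) (simp add: cond_sq_norm_def)
  finally show ?thesis by (simp add: eq)
qed

text \<open>A second moment of a product without fourth moments of the factors: |h|^2 is known to F
  and passes under the conditional expectation, where the constant c applies. Working in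
  [0, \<infinity>] lets this establish integrability instead of presupposing it.\<close>

lemma nn_integral_mult_cond_sq_norm_le:
  fixes e :: "'a \<Rightarrow> real^'n" and h :: "'a \<Rightarrow> real^'m"
  assumes le: "AE \<omega> in M. cond_sq_norm M F e \<omega> \<le> c"
    and [measurable]: "e \<in> borel_measurable M" and h: "h \<in> borel_measurable F"
  shows "(\<integral>\<^sup>+\<omega>. ennreal ((norm (h \<omega>))\<^sup>2) * ennreal ((norm (e \<omega>))\<^sup>2) \<partial>M)
    \<le> c * (\<integral>\<^sup>+\<omega>. ennreal ((norm (h \<omega>))\<^sup>2) \<partial>M)"
proof -
  have [measurable]: "h \<in> borel_measurable F" "h \<in> borel_measurable M"
    using h measurable_from_subalg[OF sub h] by auto
  have "(\<integral>\<^sup>+\<omega>. ennreal ((norm (h \<omega>))\<^sup>2) * ennreal ((norm (e \<omega>))\<^sup>2) \<partial>M)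
      = (\<integral>\<^sup>+\<omega>. ennreal ((norm (h \<omega>))\<^sup>2) * cond_sq_norm M F e \<omega> \<partial>M)"
    unfolding cond_sq_norm_def by (rule nn_cond_exp_intg[symmetric]) measurable
  also have "\<dots> \<le> (\<integral>\<^sup>+\<omega>. ennreal ((norm (h \<omega>))\<^sup>2) * c \<partial>M)"
    using le by (intro nn_integral_mono_AE) (auto elim!: eventually_mono intro: mult_left_mono)
  also have "\<dots> = c * (\<integral>\<^sup>+\<omega>. ennreal ((norm (h \<omega>))\<^sup>2) \<partial>M)"
    by (subst mult.commute, rule nn_integral_cmult) measurable
  finally show ?thesis .
qed

lemma square_integrable_of_cond_sq_norm:
  fixes e :: "'a \<Rightarrow> real^'n"
  assumes le: "AE \<omega> in M. cond_sq_norm M F e \<omega> \<le> ennreal (r\<^sup>2)"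
    and e: "e \<in> borel_measurable M"
  shows "square_integrable M e" and "(\<integral>\<omega>. (norm (e \<omega>))\<^sup>2 \<partial>M) \<le> r\<^sup>2"
proof -
  \<comment> \<open>The vector \<open>axis undefined 1\<close> is just some constant of norm one,
    which turns the weighted estimate into the plain one.\<close>
  have le': "(\<integral>\<^sup>+\<omega>. ennreal ((norm (e \<omega>))\<^sup>2) \<partial>M) \<le> ennreal (r\<^sup>2)"
    using nn_integral_mult_cond_sq_norm_le[OF le e, of "\<lambda>_. axis undefined 1 :: real^'n"]
    by (simp add: norm_axis_1 emeasure_space_1)
  show sq: "square_integrable M e"
    using e le_less_trans[OF le'] by (simp add: square_integrable_def integrable_iff_bounded)
  show "(\<integral>\<omega>. (norm (e \<omega>))\<^sup>2 \<partial>M) \<le> r\<^sup>2"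
    using le' nn_integral_eq_integral[OF square_integrable_norm_sq[OF sq]] by simp
qed

text \<open>Supplies for \<open>a\<close> and \<open>b\<close> what the locale of martingale
  differences demands, together with a variance bound. Products of square integrable functions are
  usually no more than integrable; here the constant bound on the conditional variance keeps |W - g|
  |h| square integrable, and Cauchy-Schwarz does the rest.\<close>

lemma conditionally_centered_inner:
  fixes W g h :: "'a \<Rightarrow> real^'n"
  assumes W: "square_integrable M W" and g: "square_integrable M g" "g \<in> borel_measurable F"
    and mean: "AE \<omega> in M. vec_cond_exp M F W \<omega> = g \<omega>"
    and var: "AE \<omega> in M. cond_sq_norm M F (\<lambda>\<omega>. g \<omega> - W \<omega>) \<omega> \<le> ennreal (r\<^sup>2)"
    and h: "square_integrable M h" "h \<in> borel_measurable F"
  shows "square_integrable M (\<lambda>\<omega>. (W \<omega> - g \<omega>) \<bullet> h \<omega>)"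
    and "(\<integral>\<omega>. ((W \<omega> - g \<omega>) \<bullet> h \<omega>)\<^sup>2 \<partial>M) \<le> r\<^sup>2 * (\<integral>\<omega>. (norm (h \<omega>))\<^sup>2 \<partial>M)"
    and "\<And>u. u \<in> borel_measurable F \<Longrightarrow> square_integrable M u \<Longrightarrow>
      (\<integral>\<omega>. ((W \<omega> - g \<omega>) \<bullet> h \<omega>) * u \<omega> \<partial>M) = 0"
proof -
  have [measurable]: "W \<in> borel_measurable M" "g \<in> borel_measurable M" "h \<in> borel_measurable M"
    using W g h by (auto simp: square_integrable_def)
  let ?N = "\<lambda>\<omega>. norm (W \<omega> - g \<omega>) * norm (h \<omega>)"
  have "(\<integral>\<^sup>+\<omega>. ennreal ((?N \<omega>)\<^sup>2) \<partial>M)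
      = (\<integral>\<^sup>+\<omega>. ennreal ((norm (h \<omega>))\<^sup>2) * ennreal ((norm (g \<omega> - W \<omega>))\<^sup>2) \<partial>M)"
    by (intro nn_integral_cong)
       (simp add: power_mult_distrib ennreal_mult'[symmetric] norm_minus_commute mult.commute)
  also have "\<dots> \<le> ennreal (r\<^sup>2) * (\<integral>\<^sup>+\<omega>. ennreal ((norm (h \<omega>))\<^sup>2) \<partial>M)"
    by (rule nn_integral_mult_cond_sq_norm_le[OF var _ h(2)]) measurable
  also have "\<dots> = ennreal (r\<^sup>2 * (\<integral>\<omega>. (norm (h \<omega>))\<^sup>2 \<partial>M))"
    using nn_integral_eq_integral[OF square_integrable_norm_sq[OF h(1)]] by (simp add: ennreal_mult')
  finally have le: "(\<integral>\<^sup>+\<omega>. ennreal ((?N \<omega>)\<^sup>2) \<partial>M) \<le> ennreal (r\<^sup>2 * (\<integral>\<omega>. (norm (h \<omega>))\<^sup>2 \<partial>M))" .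
  have N: "square_integrable M ?N"
    using le_less_trans[OF le] by (simp add: square_integrable_def integrable_iff_bounded)
  show m: "square_integrable M (\<lambda>\<omega>. (W \<omega> - g \<omega>) \<bullet> h \<omega>)"
    by (rule square_integrable_bound[OF N]) (auto simp: Cauchy_Schwarz_ineq2)
  have "(\<integral>\<omega>. ((W \<omega> - g \<omega>) \<bullet> h \<omega>)\<^sup>2 \<partial>M) \<le> (\<integral>\<omega>. (?N \<omega>)\<^sup>2 \<partial>M)"
  proof (rule integral_mono)
    show "((W \<omega> - g \<omega>) \<bullet> h \<omega>)\<^sup>2 \<le> (?N \<omega>)\<^sup>2" for \<omega>
      by (rule abs_le_square_iff[THEN iffD1]) (simp add: Cauchy_Schwarz_ineq2)
  qed (use square_integrable_norm_sq[OF m] square_integrable_norm_sq[OF N] in simp_all)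
  also have "\<dots> \<le> r\<^sup>2 * (\<integral>\<omega>. (norm (h \<omega>))\<^sup>2 \<partial>M)"
    using le nn_integral_eq_integral[OF square_integrable_norm_sq[OF N]] by simp
  finally show "(\<integral>\<omega>. ((W \<omega> - g \<omega>) \<bullet> h \<omega>)\<^sup>2 \<partial>M) \<le> r\<^sup>2 * (\<integral>\<omega>. (norm (h \<omega>))\<^sup>2 \<partial>M)" .
  fix u :: "'a \<Rightarrow> real" assume u: "u \<in> borel_measurable F" "square_integrable M u"
  have "(\<integral>\<omega>. (W \<omega> - g \<omega>) \<bullet> (u \<omega> *\<^sub>R h \<omega>) \<partial>M) = 0"
  proof (rule vec_cond_exp_orthogonal[OF _ _ g(2) mean])
    have "integrable M (\<lambda>\<omega>. ?N \<omega> * \<bar>u \<omega>\<bar>)"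
      using integrable_mult_of_square_integrable[OF N square_integrable_norm[OF u(2)]] by simp
    then show "integrable M (\<lambda>\<omega>. norm (W \<omega> - g \<omega>) * norm (u \<omega> *\<^sub>R h \<omega>))"
      by (simp add: mult_ac)
  qed (use W g h u square_integrable_imp_integrable' in auto)
  then show "(\<integral>\<omega>. ((W \<omega> - g \<omega>) \<bullet> h \<omega>) * u \<omega> \<partial>M) = 0" by (simp add: mult.commute)
qed

end

text \<open>A positive lower limit would bound c below by some e > 0 from an index on, and e times
  the divergent tail of the weights would be infinite. Values in \<open>ennreal\<close> let the
  lemma serve both for expectations and along single paths.\<close>

lemma liminf_eq_0_if_weighted_summable:
  fixes c :: "nat \<Rightarrow> ennreal" and l :: "nat \<Rightarrow> real"
  assumes "(\<Sum>k. ennreal (l k)) = \<infinity>" "(\<Sum>k. ennreal (l k) * c k) < \<infinity>"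
  shows "liminf c = 0"
proof (rule ccontr)
  assume "liminf c \<noteq> 0"
  then obtain e where e: "0 < e" "e < liminf c" using dense[of 0 "liminf c"] by (auto simp: zero_less_iff_neq_zero)
  then obtain N where N: "\<And>k. N \<le> k \<Longrightarrow> e < c k"
    using less_LiminfD[of e sequentially c] by (auto simp: eventually_sequentially)
  have "e < \<infinity>" using e(2) by (metis top.not_eq_extremum infinity_ennreal_def order_less_imp_not_less top_greatest order_le_less)
  have split: "(\<Sum>k. ennreal (l k)) = (\<Sum>k<N. ennreal (l k)) + (\<Sum>k. ennreal (l (k + N)))"
    by (subst suminf_offset[of _ N]) (auto simp: add.commute)
  have "(\<Sum>k<N. ennreal (l k)) < \<infinity>" by simp
  then have "(\<Sum>k. ennreal (l (k + N))) = \<infinity>" using assms(1) split by auto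
  then have "\<infinity> = e * (\<Sum>k. ennreal (l (k + N)))" using e(1) by (simp add: ennreal_mult_top)
  also have "\<dots> = (\<Sum>k. e * ennreal (l (k + N)))" by simp
  also have "\<dots> \<le> (\<Sum>k. ennreal (l (k + N)) * c (k + N))"
  proof (intro suminf_le)
    fix k show "e * ennreal (l (k + N)) \<le> ennreal (l (k + N)) * c (k + N)"
      using less_imp_le[OF N[of "k + N"]] by (subst mult.commute) (rule mult_left_mono, auto)
  qed auto
  also have "\<dots> \<le> (\<Sum>k. ennreal (l k) * c k)"
    by (subst (2) suminf_offset[of _ N]) auto
  finally show False using assms(2) by simp
qed

section \<open>The extra-step process\<close>

lemma AE_summable_of_integrable_sum:
  fixes f :: "nat \<Rightarrow> 'a \<Rightarrow> real"
  assumes f: "\<And>k. integrable M (f k)" and sum: "summable (\<lambda>k. \<integral>\<omega>. \<bar>f k \<omega>\<bar> \<partial>M)"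
  shows "AE \<omega> in M. summable (\<lambda>k. \<bar>f k \<omega>\<bar>)"
proof -
  have [measurable]: "f k \<in> borel_measurable M" for k using f by auto
  have "(\<integral>\<^sup>+\<omega>. (\<Sum>k. ennreal \<bar>f k \<omega>\<bar>) \<partial>M) = (\<Sum>k. \<integral>\<^sup>+\<omega>. ennreal \<bar>f k \<omega>\<bar> \<partial>M)"
    by (rule nn_integral_suminf) measurable
  also have "\<dots> = (\<Sum>k. ennreal (\<integral>\<omega>. \<bar>f k \<omega>\<bar> \<partial>M))"
    using f by (intro suminf_cong nn_integral_eq_integral) auto
  also have "\<dots> \<noteq> \<infinity>" using sum by (simp add: ennreal_suminf_neq_top)
  finally have "AE \<omega> in M. (\<Sum>k. ennreal \<bar>f k \<omega>\<bar>) \<noteq> \<infinity>"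
    by (intro nn_integral_PInf_AE) auto
  then show ?thesis by eventually_elim (auto intro: summable_suminf_not_top)
qed

lemma summable_mult_nonneg:
  fixes u v :: "nat \<Rightarrow> real"
  assumes "summable u" "summable v" "\<And>k. 0 \<le> u k" "\<And>k. 0 \<le> v k"
  shows "summable (\<lambda>k. u k * v k)"
proof (rule summable_comparison_test')
  show "summable (\<lambda>k. suminf u * v k)" using assms by (intro summable_mult)
  fix k show "norm (u k * v k) \<le> suminf u * v k"
    using assms sum_le_suminf[OF assms(1), of "{k}"] by (auto intro!: mult_right_mono)
qed

text \<open>Abstract filtrations: \<open>G k\<close> is the information that determines X k,
  \<open>H k\<close> adds V k, and Vp k is known in \<open>G (Suc k)\<close>. The index of G is thus
  one ahead of the \<open>filt_plus\<close> of the method, which gives the trivial \<sigma>-algebra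
  the index 0. Matrices have been replaced by scalars through \<open>px\<close>.\<close>

locale extra_step_process = prob_space M + convex_lsc_proper \<phi>
  for M :: "'a measure" and \<phi> :: "real^'n \<Rightarrow> ereal" +
  fixes f :: "real^'n \<Rightarrow> real" and x0 :: "real^'n"
    and \<alpha> \<beta> lam lam\<^sub>p \<nu> \<sigma> \<sigma>\<^sub>p :: "nat \<Rightarrow> real"
    and L\<^sub>f \<rho> c :: real
    and G H :: "nat \<Rightarrow> 'a measure"
    and V D V\<^sub>p X Z :: "nat \<Rightarrow> 'a \<Rightarrow> real^'n"
  assumes f: "cont_diff f"
    and lip: "L\<^sub>f-lipschitz_on UNIV (grad f)" and L_ge: "1 \<le> L\<^sub>f"
    and lower: "\<And>x. x \<in> dom \<Longrightarrow> c \<le> f x + \<phi>r x"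
    and lam_pos: "\<And>k. 0 < lam k" and lamp_pos: "\<And>k. 0 < lam\<^sub>p k"
    and x0: "x0 \<in> dom" and alpha: "\<And>k. 0 \<le> \<alpha> k" and beta: "\<And>k. 0 \<le> \<beta> k"
    and X_0: "\<And>\<omega>. \<omega> \<in> space M \<Longrightarrow> X 0 \<omega> = x0"
    and Z_eq: "\<And>\<omega> k. \<omega> \<in> space M \<Longrightarrow> Z k \<omega> = X k \<omega> + \<beta> k *\<^sub>R D k \<omega>"
    and X_Suc: "\<And>\<omega> k. \<omega> \<in> space M \<Longrightarrow>
      X (Suc k) \<omega> = px (lam\<^sub>p k) (X k \<omega> + \<alpha> k *\<^sub>R D k \<omega> - lam\<^sub>p k *\<^sub>R V\<^sub>p k \<omega>)"
    and sub_G: "\<And>k. subalgebra M (G k)" and sub_H: "\<And>k. subalgebra M (H k)"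
    and G_H: "\<And>k. sets (G k) \<subseteq> sets (H k)" and H_G: "\<And>k. sets (H k) \<subseteq> sets (G (Suc k))"
    and V_H: "\<And>k. V k \<in> borel_measurable (H k)"
    and D_H: "\<And>k. D k \<in> borel_measurable (H k)"
    and Vp_G: "\<And>k. V\<^sub>p k \<in> borel_measurable (G (Suc k))"
    and D_bound: "\<And>k. AE \<omega> in M. cond_sq_norm M (G k) (D k) \<omega> \<le> ennreal ((\<nu> k)\<^sup>2) *
      cond_sq_norm M (G k) (\<lambda>\<omega>. X k \<omega> - px (lam k) (X k \<omega> - lam k *\<^sub>R V k \<omega>)) \<omega>"
    and V_mean: "\<And>k. AE \<omega> in M. vec_cond_exp M (G k) (V k) \<omega> = grad f (X k \<omega>)"
    and Vp_mean: "\<And>k. AE \<omega> in M. vec_cond_exp M (H k) (V\<^sub>p k) \<omega> = grad f (Z k \<omega>)"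
    and V_var: "\<And>k. AE \<omega> in M. cond_sq_norm M (G k) (\<lambda>\<omega>. grad f (X k \<omega>) - V k \<omega>) \<omega> \<le> ennreal ((\<sigma> k)\<^sup>2)"
    and Vp_var: "\<And>k. AE \<omega> in M. cond_sq_norm M (H k) (\<lambda>\<omega>. grad f (Z k \<omega>) - V\<^sub>p k \<omega>) \<omega>
      \<le> ennreal ((\<sigma>\<^sub>p k)\<^sup>2)"
    and rho: "0 < \<rho>" "\<rho> < 1"
    and lamp_le: "\<And>k. lam\<^sub>p k \<le> 1 / L\<^sub>f"
    and lam_le: "\<And>k. lam k \<le>
      (1 - \<rho>) * lam\<^sub>p k / (1 + (\<nu> k)\<^sup>2 * (\<alpha> k + L\<^sub>f * \<beta> k * lam\<^sub>p k)\<^sup>2)"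
    and sum_V: "summable (\<lambda>k. lam k * (\<sigma> k)\<^sup>2)"
    and sum_Vp: "summable (\<lambda>k. lam\<^sub>p k * (\<sigma>\<^sub>p k)\<^sup>2)"
begin

lemma lift_G: "g \<in> borel_measurable (G k) \<Longrightarrow> g \<in> borel_measurable (H k)"
  and lift_H: "g \<in> borel_measurable (H k) \<Longrightarrow> g \<in> borel_measurable (G (Suc k))"
  using sub_G sub_H G_H H_G by (metis measurable_from_subalg subalgebra_def)+

lemma space_GH: "space (G k) = space M" "space (H k) = space M"
  using sub_G sub_H by (auto simp: subalgebra_def)

lemma grad_measurable: "g \<in> borel_measurable N \<Longrightarrow> (\<lambda>\<omega>. grad f (g \<omega>)) \<in> borel_measurable N"
  using borel_measurable_continuous_onI[OF lipschitz_on_continuous_on[OF lip]]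
  by (rule measurable_compose[rotated])

lemma X_G: "X k \<in> borel_measurable (G k)"
proof (induction k)
  case 0
  have "X 0 \<in> borel_measurable (G 0) \<longleftrightarrow> (\<lambda>_. x0) \<in> borel_measurable (G 0)"
    by (rule measurable_cong) (simp add: X_0 space_GH)
  then show ?case by simp
next
  case (Suc k)
  have [measurable]: "X k \<in> borel_measurable (G (Suc k))" "D k \<in> borel_measurable (G (Suc k))"
      "V\<^sub>p k \<in> borel_measurable (G (Suc k))"
    by (rule lift_H[OF lift_G[OF Suc]] lift_H[OF D_H] Vp_G)+
  have "X (Suc k) \<in> borel_measurable (G (Suc k)) \<longleftrightarrow>
      (\<lambda>\<omega>. px (lam\<^sub>p k) (X k \<omega> + \<alpha> k *\<^sub>R D k \<omega> - lam\<^sub>p k *\<^sub>R V\<^sub>p k \<omega>)) \<in> borel_measurable (G (Suc k))"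
    by (rule measurable_cong) (simp add: X_Suc space_GH)
  also have "\<dots>" by (intro measurable_px lamp_pos) measurable
  finally show ?case .
qed

lemma Z_H: "Z k \<in> borel_measurable (H k)"
proof -
  have [measurable]: "X k \<in> borel_measurable (H k)" "D k \<in> borel_measurable (H k)"
    using lift_G X_G D_H by auto
  have "Z k \<in> borel_measurable (H k) \<longleftrightarrow> (\<lambda>\<omega>. X k \<omega> + \<beta> k *\<^sub>R D k \<omega>) \<in> borel_measurable (H k)"
    by (rule measurable_cong) (simp add: Z_eq space_GH)
  also have "\<dots>" by measurable
  finally show ?thesis .
qed

lemma X_M [measurable]: "X k \<in> borel_measurable M"
  and D_M [measurable]: "D k \<in> borel_measurable M"
  and Z_M [measurable]: "Z k \<in> borel_measurable M"
  and V_M [measurable]: "V k \<in> borel_measurable M"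
  and Vp_M [measurable]: "V\<^sub>p k \<in> borel_measurable M"
  and gX_M [measurable]: "(\<lambda>\<omega>. grad f (X k \<omega>)) \<in> borel_measurable M"
  and gZ_M [measurable]: "(\<lambda>\<omega>. grad f (Z k \<omega>)) \<in> borel_measurable M"
  using measurable_from_subalg[OF sub_G X_G] measurable_from_subalg[OF sub_H D_H]
    measurable_from_subalg[OF sub_H Z_H] measurable_from_subalg[OF sub_H V_H]
    measurable_from_subalg[OF sub_G Vp_G] by (auto intro: grad_measurable)

lemma X_dom: "\<omega> \<in> space M \<Longrightarrow> X k \<omega> \<in> dom"
  by (cases k) (simp_all add: X_0 x0 X_Suc px_dom lamp_pos)

lemma px_lipschitz: "0 < t \<Longrightarrow> 1-lipschitz_on UNIV (px t)"
  by (simp add: lipschitz_on_def dist_norm px_nonexpansive)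

lemma V_err: "square_integrable M (\<lambda>\<omega>. grad f (X k \<omega>) - V k \<omega>)"
    "(\<integral>\<omega>. (norm (grad f (X k \<omega>) - V k \<omega>))\<^sup>2 \<partial>M) \<le> (\<sigma> k)\<^sup>2"
  by (intro square_integrable_of_cond_sq_norm[OF prob_space_axioms sub_G V_var]; measurable)+

lemma Vp_err: "square_integrable M (\<lambda>\<omega>. grad f (Z k \<omega>) - V\<^sub>p k \<omega>)"
    "(\<integral>\<omega>. (norm (grad f (Z k \<omega>) - V\<^sub>p k \<omega>))\<^sup>2 \<partial>M) \<le> (\<sigma>\<^sub>p k)\<^sup>2"
  by (intro square_integrable_of_cond_sq_norm[OF prob_space_axioms sub_H Vp_var]; measurable)+

section \<open>Residuals, displacements and their noise-free versions\<close>

definition F :: "nat \<Rightarrow> 'a \<Rightarrow> real^'n" where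
  "F k \<omega> = X k \<omega> - px (lam k) (X k \<omega> - lam k *\<^sub>R V k \<omega>)"

text \<open>Not the conditional mean of F: the estimate V inside the proximal map is replaced by its
  conditional mean. The result is known to \<open>G k\<close>, whereas F itself contains V k and is
  correlated with the error of V k.\<close>

definition F_mean :: "nat \<Rightarrow> 'a \<Rightarrow> real^'n" where
  "F_mean k \<omega> = X k \<omega> - px (lam k) (X k \<omega> - lam k *\<^sub>R grad f (X k \<omega>))"

definition W :: "nat \<Rightarrow> 'a \<Rightarrow> real^'n" where
  "W k \<omega> = px (lam k) (X k \<omega> - lam k *\<^sub>R V k \<omega>) - X (Suc k) \<omega>"

text \<open>V k may stay, being known to \<open>H k\<close>; only Vp is replaced by its mean. The
  orientation is y - p, opposite to that in the descent inequality, and the error factor in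
  \<open>b\<close> is reversed as well, so the product is the same.\<close>

definition W_mean :: "nat \<Rightarrow> 'a \<Rightarrow> real^'n" where
  "W_mean k \<omega> = px (lam k) (X k \<omega> - lam k *\<^sub>R V k \<omega>)
     - px (lam\<^sub>p k) (X k \<omega> + \<alpha> k *\<^sub>R D k \<omega> - lam\<^sub>p k *\<^sub>R grad f (Z k \<omega>))"

lemma F_mean_G: "F_mean k \<in> borel_measurable (G k)"
  unfolding F_mean_def
  by (intro borel_measurable_diff measurable_px borel_measurable_scaleR grad_measurable X_G lam_pos) simp

lemma W_mean_H: "W_mean k \<in> borel_measurable (H k)"
  unfolding W_mean_def
  by (intro borel_measurable_diff borel_measurable_add measurable_px borel_measurable_scaleR
      grad_measurable lift_G X_G Z_H V_H D_H lam_pos lamp_pos) simp_all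

text \<open>No square integrability of the data is assumed: it propagates along the recursion from the
  deterministic starting point through the bounds on the conditional second moments.\<close>

lemma square_integrable_step:
  assumes X: "square_integrable M (X k)"
  shows "square_integrable M (V k)" "square_integrable M (F k)" "square_integrable M (D k)"
    "(\<integral>\<omega>. (norm (D k \<omega>))\<^sup>2 \<partial>M) \<le> (\<nu> k)\<^sup>2 * (\<integral>\<omega>. (norm (F k \<omega>))\<^sup>2 \<partial>M)"
    "square_integrable M (Z k)" "square_integrable M (V\<^sub>p k)" "square_integrable M (X (Suc k))"
proof -
  have gX: "square_integrable M (\<lambda>\<omega>. grad f (X k \<omega>))"
    by (rule square_integrable_lipschitz_compose[OF lip X])
  then show V: "square_integrable M (V k)"
    using square_integrable_diff[OF gX V_err(1)[of k]] by simp
  have "square_integrable M (\<lambda>\<omega>. X k \<omega> - px (lam k) (X k \<omega> - lam k *\<^sub>R V k \<omega>))"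
    by (intro square_integrable_diff square_integrable_scaleR X V
        square_integrable_lipschitz_compose[OF px_lipschitz] lam_pos)
  then show F: "square_integrable M (F k)" by (simp add: F_def[abs_def])
  have "(\<integral>\<^sup>+\<omega>. ennreal ((norm (D k \<omega>))\<^sup>2) \<partial>M) \<le> ennreal ((\<nu> k)\<^sup>2) * (\<integral>\<^sup>+\<omega>. ennreal ((norm (F k \<omega>))\<^sup>2) \<partial>M)"
    using nn_integral_cond_sq_norm_le[OF prob_space_axioms sub_G D_bound D_M, of k]
      square_integrable_measurable[OF F] by (simp add: F_def[abs_def])
  also have "\<dots> = ennreal ((\<nu> k)\<^sup>2 * (\<integral>\<omega>. (norm (F k \<omega>))\<^sup>2 \<partial>M))"
    using nn_integral_eq_integral[OF square_integrable_norm_sq[OF F]] by (simp add: ennreal_mult')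
  finally have le: "(\<integral>\<^sup>+\<omega>. ennreal ((norm (D k \<omega>))\<^sup>2) \<partial>M) \<le> ennreal ((\<nu> k)\<^sup>2 * (\<integral>\<omega>. (norm (F k \<omega>))\<^sup>2 \<partial>M))" .
  then show D: "square_integrable M (D k)"
    using le_less_trans[OF le] by (simp add: square_integrable_def integrable_iff_bounded)
  show "(\<integral>\<omega>. (norm (D k \<omega>))\<^sup>2 \<partial>M) \<le> (\<nu> k)\<^sup>2 * (\<integral>\<omega>. (norm (F k \<omega>))\<^sup>2 \<partial>M)"
    using le nn_integral_eq_integral[OF square_integrable_norm_sq[OF D]] by simp
  have "square_integrable M (\<lambda>\<omega>. X k \<omega> + \<beta> k *\<^sub>R D k \<omega>)"
    by (intro square_integrable_add square_integrable_scaleR X D)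
  then show Z: "square_integrable M (Z k)"
    by (subst square_integrable_cong[OF Z_eq])
  have gZ: "square_integrable M (\<lambda>\<omega>. grad f (Z k \<omega>))"
    by (rule square_integrable_lipschitz_compose[OF lip Z])
  then show Vp: "square_integrable M (V\<^sub>p k)"
    using square_integrable_diff[OF gZ Vp_err(1)[of k]] by simp
  have "square_integrable M (\<lambda>\<omega>. px (lam\<^sub>p k) (X k \<omega> + \<alpha> k *\<^sub>R D k \<omega> - lam\<^sub>p k *\<^sub>R V\<^sub>p k \<omega>))"
    by (intro square_integrable_lipschitz_compose[OF px_lipschitz] square_integrable_diff
        square_integrable_add square_integrable_scaleR X D Vp lamp_pos)
  then show "square_integrable M (X (Suc k))"
    by (subst square_integrable_cong[OF X_Suc])
qed

lemma X_sq: "square_integrable M (X k)"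
proof (induction k)
  case 0
  show ?case by (subst square_integrable_cong[OF X_0]) (simp_all add: square_integrable_const)
qed (rule square_integrable_step)

lemmas V_sq = square_integrable_step(1)[OF X_sq]
  and F_sq = square_integrable_step(2)[OF X_sq]
  and D_sq = square_integrable_step(3)[OF X_sq]
  and D_le_F = square_integrable_step(4)[OF X_sq]
  and Vp_sq = square_integrable_step(6)[OF X_sq]
  and grad_X_sq = square_integrable_lipschitz_compose[OF lip X_sq]
  and grad_Z_sq = square_integrable_lipschitz_compose[OF lip square_integrable_step(5)[OF X_sq]]

lemma W_sq: "square_integrable M (W k)"
  using square_integrable_diff[OF square_integrable_diff[OF X_sq F_sq] X_sq, of k k "Suc k"]
  by (simp add: W_def[abs_def] F_def)

lemma F_mean_sq: "square_integrable M (F_mean k)"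
  unfolding F_mean_def[abs_def]
  by (intro square_integrable_diff square_integrable_scaleR X_sq grad_X_sq
      square_integrable_lipschitz_compose[OF px_lipschitz] lam_pos)

lemma W_mean_sq: "square_integrable M (W_mean k)"
  unfolding W_mean_def[abs_def]
  by (intro square_integrable_diff square_integrable_add square_integrable_scaleR X_sq V_sq D_sq grad_Z_sq
      square_integrable_lipschitz_compose[OF px_lipschitz] lam_pos lamp_pos)

definition a :: "nat \<Rightarrow> 'a \<Rightarrow> real" where
  "a k \<omega> = (V k \<omega> - grad f (X k \<omega>)) \<bullet> F_mean k \<omega>"

definition b :: "nat \<Rightarrow> 'a \<Rightarrow> real" where
  "b k \<omega> = (V\<^sub>p k \<omega> - grad f (Z k \<omega>)) \<bullet> W_mean k \<omega>"

abbreviation EF where "EF k \<equiv> (\<integral>\<omega>. (norm (F k \<omega>))\<^sup>2 \<partial>M)"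
abbreviation EW where "EW k \<equiv> (\<integral>\<omega>. (norm (W k \<omega>))\<^sup>2 \<partial>M)"
abbreviation \<kappa> where "\<kappa> k \<equiv> \<alpha> k + L\<^sub>f * \<beta> k * lam\<^sub>p k"

lemmas a_props = conditionally_centered_inner[OF prob_space_axioms sub_G V_sq grad_X_sq
  grad_measurable[OF X_G] V_mean V_var F_mean_sq F_mean_G, folded a_def]

lemmas b_props = conditionally_centered_inner[OF prob_space_axioms sub_H Vp_sq grad_Z_sq
  grad_measurable[OF Z_H] Vp_mean Vp_var W_mean_sq W_mean_H, folded b_def]

sublocale a: L2_martingale_differences M G a
proof
  fix k
  show "sets (G k) \<subseteq> sets (G (Suc k))" using G_H H_G by blast
  have "(\<lambda>\<omega>. (V k \<omega> - grad f (X k \<omega>)) \<bullet> F_mean k \<omega>) \<in> borel_measurable (G (Suc k))"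
    by (intro borel_measurable_inner borel_measurable_diff lift_H V_H lift_G grad_measurable X_G F_mean_G)
  then show "a k \<in> borel_measurable (G (Suc k))" by (simp add: a_def[abs_def])
qed (use sub_G a_props in auto)

sublocale b: L2_martingale_differences M H b
proof
  fix k
  show "sets (H k) \<subseteq> sets (H (Suc k))" using G_H[of "Suc k"] H_G by blast
  have "(\<lambda>\<omega>. (V\<^sub>p k \<omega> - grad f (Z k \<omega>)) \<bullet> W_mean k \<omega>) \<in> borel_measurable (H (Suc k))"
    by (intro borel_measurable_inner borel_measurable_diff lift_G Vp_G)
       (intro lift_H grad_measurable Z_H W_mean_H)+
  then show "b k \<in> borel_measurable (H (Suc k))" by (simp add: b_def[abs_def])
qed (use sub_H b_props in auto)

text \<open>The bracket of \<open>extra_step_descent\<close> kept term by term: the D term can be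
  compared with the F terms only in mean.\<close>

definition r :: "nat \<Rightarrow> 'a \<Rightarrow> real" where
  "r k \<omega> = (\<kappa> k)\<^sup>2 * (norm (D k \<omega>))\<^sup>2 / lam\<^sub>p k + (norm (F k \<omega>))\<^sup>2 / (2 * lam\<^sub>p k)
     - (norm (F k \<omega>))\<^sup>2 / lam k - (norm (W k \<omega>))\<^sup>2 / (4 * lam\<^sub>p k)
     + lam k * (norm (grad f (X k \<omega>) - V k \<omega>))\<^sup>2 + lam\<^sub>p k * (norm (grad f (Z k \<omega>) - V\<^sub>p k \<omega>))\<^sup>2"

section \<open>Descent of the objective, pathwise and in mean\<close>

definition P :: "nat \<Rightarrow> 'a \<Rightarrow> real" where "P k \<omega> = f (X k \<omega>) + \<phi>r (X k \<omega>)"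

lemma P_step: "\<omega> \<in> space M \<Longrightarrow> P (Suc k) \<omega> \<le> P k \<omega> + (a k \<omega> + b k \<omega> + r k \<omega>)"
  using extra_step_descent[OF f lip L_ge lam_pos lamp_pos lamp_le alpha beta X_dom,
      where D = "D k \<omega>" and V = "V k \<omega>" and Vp = "V\<^sub>p k \<omega>", of \<omega> k k k k]
  unfolding P_def a_def b_def r_def F_def W_def F_mean_def W_mean_def
  by (simp add: X_Suc Z_eq inner_diff_left inner_diff_right norm_minus_commute algebra_simps)

lemma P_lower: "\<omega> \<in> space M \<Longrightarrow> c \<le> P k \<omega>"
  using lower[OF X_dom] by (simp add: P_def)

lemma a_int: "integrable M (a k)" and b_int: "integrable M (b k)"
  by (intro square_integrable_imp_integrable' a_props b_props)+

lemmas norm_sq_int = square_integrable_norm_sq[OF F_sq] square_integrable_norm_sq[OF W_sq]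
  square_integrable_norm_sq[OF D_sq] square_integrable_norm_sq[OF V_err(1)]
  square_integrable_norm_sq[OF Vp_err(1)]

lemma r_int: "integrable M (r k)"
  unfolding r_def[abs_def] using norm_sq_int by auto

lemma continuous_f: "continuous_on UNIV f"
  using f by (auto simp: cont_diff_def intro!: continuous_at_imp_continuous_on differentiable_imp_continuous_within)

lemma P_measurable [measurable]: "P k \<in> borel_measurable M"
proof -
  have [measurable]: "f \<in> borel_measurable borel" by (rule borel_measurable_continuous_onI[OF continuous_f])
  show ?thesis unfolding P_def[abs_def] by measurable
qed

text \<open>Square integrability of X does not help, since \<phi> may grow arbitrarily fast on its
  domain. Instead \<open>P (Suc k)\<close> is caught between the constant c and the right-hand side
  of the descent inequality, which is integrable by induction.\<close>

lemma P_int: "integrable M (P k)"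
proof (induction k)
  case 0
  have "integrable M (P 0) \<longleftrightarrow> integrable M (\<lambda>_. f x0 + \<phi>r x0)"
    by (rule Bochner_Integration.integrable_cong) (simp_all add: P_def X_0)
  then show ?case by simp
next
  case (Suc k)
  have "integrable M (\<lambda>\<omega>. \<bar>c\<bar> + \<bar>P k \<omega> + (a k \<omega> + b k \<omega> + r k \<omega>)\<bar>)"
    using Suc a_int b_int r_int by auto
  then show ?case
  proof (rule Bochner_Integration.integrable_bound)
    show "AE \<omega> in M. norm (P (Suc k) \<omega>) \<le> norm (\<bar>c\<bar> + \<bar>P k \<omega> + (a k \<omega> + b k \<omega> + r k \<omega>)\<bar>)"
    proof (rule AE_I2)
      fix \<omega> assume "\<omega> \<in> space M"
      from P_step[OF this, of k] P_lower[OF this, of "Suc k"]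
      show "norm (P (Suc k) \<omega>) \<le> norm (\<bar>c\<bar> + \<bar>P k \<omega> + (a k \<omega> + b k \<omega> + r k \<omega>)\<bar>)"
        by (simp add: abs_le_iff) linarith
    qed
  qed measurable
qed

lemma lam_lamp: "(1 + (\<nu> k)\<^sup>2 * (\<kappa> k)\<^sup>2) / lam\<^sub>p k \<le> (1 - \<rho>) / lam k"
proof -
  have "0 < 1 + (\<nu> k)\<^sup>2 * (\<kappa> k)\<^sup>2" by (intro add_pos_nonneg) auto
  then show ?thesis using lam_le[of k] lam_pos[of k] lamp_pos[of k] by (simp add: field_simps)
qed

text \<open>Admits the step size as the parameter t in \<open>residual_scaling\<close>.\<close>

lemma lam_le_1: "lam k \<le> 1"
proof -
  have "1 / lam\<^sub>p k \<le> (1 + (\<nu> k)\<^sup>2 * (\<kappa> k)\<^sup>2) / lam\<^sub>p k"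
    using lamp_pos[of k] by (intro divide_right_mono) auto
  also have "\<dots> \<le> 1 / lam k"
    using lam_lamp[of k] lam_pos[of k] rho divide_right_mono[of "1 - \<rho>" 1 "lam k"] by linarith
  finally have "lam k \<le> lam\<^sub>p k" using lam_pos[of k] lamp_pos[of k] by (simp add: field_simps)
  also have "\<dots> \<le> 1 / L\<^sub>f" by (rule lamp_le)
  also have "\<dots> \<le> 1" using L_ge by simp
  finally show ?thesis .
qed

text \<open>The D term contributes \<nu>^2 \<kappa>^2 and the proximal step 1/2, rounded up to 1,
  both times E|F|^2 / \<open>lam\<^sub>p\<close>. The step size rule is tailored to this sum:
  against the available E|F|^2 / lam a share \<rho> remains.\<close>

lemma step_coefficients:
  "(\<kappa> k)\<^sup>2 * (\<integral>\<omega>. (norm (D k \<omega>))\<^sup>2 \<partial>M) / lam\<^sub>p k + EF k / (2 * lam\<^sub>p k) \<le> (1 - \<rho>) * EF k / lam k"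
proof -
  have EF: "0 \<le> EF k" by simp
  have "(\<kappa> k)\<^sup>2 * (\<integral>\<omega>. (norm (D k \<omega>))\<^sup>2 \<partial>M) / lam\<^sub>p k \<le> (\<kappa> k)\<^sup>2 * ((\<nu> k)\<^sup>2 * EF k) / lam\<^sub>p k"
    using lamp_pos[of k] by (intro divide_right_mono mult_left_mono D_le_F) auto
  moreover have "EF k / (2 * lam\<^sub>p k) \<le> EF k / lam\<^sub>p k"
    using lamp_pos[of k] EF by (simp add: field_simps)
  moreover have "(\<kappa> k)\<^sup>2 * ((\<nu> k)\<^sup>2 * EF k) / lam\<^sub>p k + EF k / lam\<^sub>p k
      = (1 + (\<nu> k)\<^sup>2 * (\<kappa> k)\<^sup>2) / lam\<^sub>p k * EF k"
    by (simp add: add_divide_distrib algebra_simps)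
  moreover have "\<dots> \<le> (1 - \<rho>) / lam k * EF k" by (intro mult_right_mono lam_lamp EF)
  ultimately show ?thesis by simp
qed

lemma integral_r:
  "(\<integral>\<omega>. r k \<omega> \<partial>M) = (\<kappa> k)\<^sup>2 * (\<integral>\<omega>. (norm (D k \<omega>))\<^sup>2 \<partial>M) / lam\<^sub>p k + EF k / (2 * lam\<^sub>p k)
     - EF k / lam k - EW k / (4 * lam\<^sub>p k)
     + lam k * (\<integral>\<omega>. (norm (grad f (X k \<omega>) - V k \<omega>))\<^sup>2 \<partial>M)
     + lam\<^sub>p k * (\<integral>\<omega>. (norm (grad f (Z k \<omega>) - V\<^sub>p k \<omega>))\<^sup>2 \<partial>M)"
  unfolding r_def using norm_sq_int by simp

lemma noise_le:
  "lam k * (\<integral>\<omega>. (norm (grad f (X k \<omega>) - V k \<omega>))\<^sup>2 \<partial>M) \<le> lam k * (\<sigma> k)\<^sup>2"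
  "lam\<^sub>p k * (\<integral>\<omega>. (norm (grad f (Z k \<omega>) - V\<^sub>p k \<omega>))\<^sup>2 \<partial>M) \<le> lam\<^sub>p k * (\<sigma>\<^sub>p k)\<^sup>2"
  using lam_pos[of k] lamp_pos[of k] by (intro mult_left_mono V_err Vp_err; simp)+

lemma expected_descent:
  "(\<integral>\<omega>. P (Suc k) \<omega> \<partial>M) + (\<rho> * EF k / lam k + EW k / (4 * lam\<^sub>p k))
     \<le> (\<integral>\<omega>. P k \<omega> \<partial>M) + (lam k * (\<sigma> k)\<^sup>2 + lam\<^sub>p k * (\<sigma>\<^sub>p k)\<^sup>2)"
proof -
  have "(\<integral>\<omega>. P (Suc k) \<omega> \<partial>M) \<le> (\<integral>\<omega>. P k \<omega> + (a k \<omega> + b k \<omega> + r k \<omega>) \<partial>M)"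
    by (intro integral_mono P_int P_step Bochner_Integration.integrable_add a_int b_int r_int)
  also have "\<dots> = (\<integral>\<omega>. P k \<omega> \<partial>M) + (\<integral>\<omega>. r k \<omega> \<partial>M)"
    using P_int a_int b_int r_int by (simp add: a.integral_m b.integral_m)
  finally show ?thesis
    using integral_r[of k] noise_le[of k] step_coefficients[of k]
    by (simp add: left_diff_distrib diff_divide_distrib)
qed

text \<open>Telescoping \<open>expected_descent\<close> against the lower bound c. The two weights,
  1 / lam and 1 / \<open>lam\<^sub>p\<close>, are those that the variances of \<open>a\<close> and
  \<open>b\<close> call for.\<close>

lemma summable_EF_EW: "summable (\<lambda>k. EF k / lam k)" "summable (\<lambda>k. EW k / lam\<^sub>p k)"
proof -
  let ?n = "\<lambda>k. lam k * (\<sigma> k)\<^sup>2 + lam\<^sub>p k * (\<sigma>\<^sub>p k)\<^sup>2"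
  let ?t = "\<lambda>k. \<rho> * EF k / lam k + EW k / (4 * lam\<^sub>p k)"
  have n: "summable ?n" by (intro summable_add sum_V sum_Vp)
  have n0: "0 \<le> ?n k" for k using lam_pos[of k] lamp_pos[of k] by simp
  have t0: "0 \<le> \<rho> * EF k / lam k" "0 \<le> EW k / (4 * lam\<^sub>p k)" for k
    using lam_pos[of k] lamp_pos[of k] rho by simp_all
  have part: "(\<integral>\<omega>. P m \<omega> \<partial>M) + (\<Sum>k<m. ?t k) \<le> (\<integral>\<omega>. P 0 \<omega> \<partial>M) + (\<Sum>k<m. ?n k)" for m
  proof (induction m)
    case (Suc m)
    then show ?case using expected_descent[of m] by simp
  qed simp
  have bound: "(\<Sum>k<m. ?t k) \<le> (\<integral>\<omega>. P 0 \<omega> \<partial>M) + suminf ?n - c" for m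
  proof -
    have "c \<le> (\<integral>\<omega>. P m \<omega> \<partial>M)"
      using integral_mono[of M "\<lambda>_. c" "P m"] P_int P_lower by (simp add: prob_space)
    moreover have "(\<Sum>k<m. ?n k) \<le> suminf ?n" by (rule sum_le_suminf[OF n]) (use n0 in auto)
    ultimately show ?thesis using part[of m] by linarith
  qed
  have t: "summable ?t"
    by (rule summableI_nonneg_bounded[OF _ bound]) (intro add_nonneg_nonneg t0)
  have "summable (\<lambda>k. \<rho> * EF k / lam k)"
    by (rule summable_comparison_test'[OF t, of 0]) (use t0 in \<open>simp only: real_norm_def abs_of_nonneg le_add_same_cancel1 le_add_same_cancel2\<close>)
  then have "summable (\<lambda>k. inverse \<rho> * (\<rho> * EF k / lam k))" by (rule summable_mult)
  then show "summable (\<lambda>k. EF k / lam k)" using rho by (simp add: mult.assoc[symmetric])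
  have "summable (\<lambda>k. EW k / (4 * lam\<^sub>p k))"
    by (rule summable_comparison_test'[OF t, of 0]) (use t0 in \<open>simp only: real_norm_def abs_of_nonneg le_add_same_cancel1 le_add_same_cancel2\<close>)
  then have "summable (\<lambda>k. 4 * (EW k / (4 * lam\<^sub>p k)))" by (rule summable_mult)
  then show "summable (\<lambda>k. EW k / lam\<^sub>p k)" by simp
qed

lemma F_mean_le:
  "(norm (F_mean k \<omega>))\<^sup>2 \<le> 2 * (norm (F k \<omega>))\<^sup>2 + 2 * (lam k)\<^sup>2 * (norm (grad f (X k \<omega>) - V k \<omega>))\<^sup>2"
proof -
  let ?d = "F_mean k \<omega> - F k \<omega>"
  have "norm ?d \<le> norm ((X k \<omega> - lam k *\<^sub>R V k \<omega>) - (X k \<omega> - lam k *\<^sub>R grad f (X k \<omega>)))"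
    using px_nonexpansive[OF lam_pos, of k "X k \<omega> - lam k *\<^sub>R V k \<omega>" "X k \<omega> - lam k *\<^sub>R grad f (X k \<omega>)"]
    by (simp add: F_mean_def F_def)
  also have "(X k \<omega> - lam k *\<^sub>R V k \<omega>) - (X k \<omega> - lam k *\<^sub>R grad f (X k \<omega>))
      = lam k *\<^sub>R (grad f (X k \<omega>) - V k \<omega>)" by (simp add: algebra_simps)
  finally have "(norm ?d)\<^sup>2 \<le> (lam k * norm (grad f (X k \<omega>) - V k \<omega>))\<^sup>2"
    using lam_pos[of k] by (intro power_mono) auto
  then show ?thesis
    using norm_add_sq_le[of "F k \<omega>" ?d] by (simp add: power_mult_distrib)
qed

lemma W_mean_le:
  assumes "\<omega> \<in> space M"
  shows "(norm (W_mean k \<omega>))\<^sup>2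
    \<le> 2 * (norm (W k \<omega>))\<^sup>2 + 2 * (lam\<^sub>p k)\<^sup>2 * (norm (grad f (Z k \<omega>) - V\<^sub>p k \<omega>))\<^sup>2"
proof -
  let ?d = "W_mean k \<omega> - W k \<omega>"
  let ?u = "X k \<omega> + \<alpha> k *\<^sub>R D k \<omega>"
  have "norm ?d \<le> norm ((?u - lam\<^sub>p k *\<^sub>R V\<^sub>p k \<omega>) - (?u - lam\<^sub>p k *\<^sub>R grad f (Z k \<omega>)))"
    using px_nonexpansive[OF lamp_pos, of k "?u - lam\<^sub>p k *\<^sub>R V\<^sub>p k \<omega>" "?u - lam\<^sub>p k *\<^sub>R grad f (Z k \<omega>)"]
    by (simp add: W_mean_def W_def X_Suc[OF assms])
  also have "(?u - lam\<^sub>p k *\<^sub>R V\<^sub>p k \<omega>) - (?u - lam\<^sub>p k *\<^sub>R grad f (Z k \<omega>))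
      = lam\<^sub>p k *\<^sub>R (grad f (Z k \<omega>) - V\<^sub>p k \<omega>)" by (simp add: algebra_simps)
  finally have "(norm ?d)\<^sup>2 \<le> (lam\<^sub>p k * norm (grad f (Z k \<omega>) - V\<^sub>p k \<omega>))\<^sup>2"
    using lamp_pos[of k] by (intro power_mono) auto
  then show ?thesis
    using norm_add_sq_le[of "W k \<omega>" ?d] by (simp add: power_mult_distrib)
qed

lemma EF_mean_le: "(\<integral>\<omega>. (norm (F_mean k \<omega>))\<^sup>2 \<partial>M) \<le> 2 * EF k + 2 * (lam k)\<^sup>2 * (\<sigma> k)\<^sup>2"
proof -
  have "(\<integral>\<omega>. (norm (F_mean k \<omega>))\<^sup>2 \<partial>M) \<le>
      (\<integral>\<omega>. 2 * (norm (F k \<omega>))\<^sup>2 + 2 * (lam k)\<^sup>2 * (norm (grad f (X k \<omega>) - V k \<omega>))\<^sup>2 \<partial>M)"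
    using norm_sq_int square_integrable_norm_sq[OF F_mean_sq] F_mean_le by (intro integral_mono) auto
  also have "\<dots> = 2 * EF k + 2 * (lam k)\<^sup>2 * (\<integral>\<omega>. (norm (grad f (X k \<omega>) - V k \<omega>))\<^sup>2 \<partial>M)"
    using norm_sq_int by simp
  also have "\<dots> \<le> 2 * EF k + 2 * (lam k)\<^sup>2 * (\<sigma> k)\<^sup>2"
    by (intro add_left_mono mult_left_mono V_err) auto
  finally show ?thesis .
qed

lemma EW_mean_le: "(\<integral>\<omega>. (norm (W_mean k \<omega>))\<^sup>2 \<partial>M) \<le> 2 * EW k + 2 * (lam\<^sub>p k)\<^sup>2 * (\<sigma>\<^sub>p k)\<^sup>2"
proof -
  have "(\<integral>\<omega>. (norm (W_mean k \<omega>))\<^sup>2 \<partial>M) \<le>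
      (\<integral>\<omega>. 2 * (norm (W k \<omega>))\<^sup>2 + 2 * (lam\<^sub>p k)\<^sup>2 * (norm (grad f (Z k \<omega>) - V\<^sub>p k \<omega>))\<^sup>2 \<partial>M)"
    using norm_sq_int square_integrable_norm_sq[OF W_mean_sq] W_mean_le by (intro integral_mono) auto
  also have "\<dots> = 2 * EW k + 2 * (lam\<^sub>p k)\<^sup>2 * (\<integral>\<omega>. (norm (grad f (Z k \<omega>) - V\<^sub>p k \<omega>))\<^sup>2 \<partial>M)"
    using norm_sq_int by simp
  also have "\<dots> \<le> 2 * EW k + 2 * (lam\<^sub>p k)\<^sup>2 * (\<sigma>\<^sub>p k)\<^sup>2"
    by (intro add_left_mono mult_left_mono Vp_err) auto
  finally show ?thesis .
qed

text \<open>In s^2 E = (t s^2) (E / t) the step size cancels, so u is dominated by products of terms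
  of summable nonnegative sequences, however s and t behave separately.\<close>

lemma summable_noise_product:
  fixes t s E u :: "nat \<Rightarrow> real"
  assumes t: "\<And>k. 0 < t k" and E: "\<And>k. 0 \<le> E k" and ts: "summable (\<lambda>k. t k * (s k)\<^sup>2)"
    and Et: "summable (\<lambda>k. E k / t k)"
    and u: "\<And>k. 0 \<le> u k" "\<And>k. u k \<le> (s k)\<^sup>2 * (2 * E k + 2 * (t k)\<^sup>2 * (s k)\<^sup>2)"
  shows "summable u"
proof (rule summable_comparison_test')
  have "summable (\<lambda>k. (t k * (s k)\<^sup>2) * (E k / t k + t k * (s k)\<^sup>2))"
    using t E by (intro summable_mult_nonneg summable_add ts Et) (auto simp: less_imp_le)
  then show "summable (\<lambda>k. 2 * ((t k * (s k)\<^sup>2) * (E k / t k + t k * (s k)\<^sup>2)))" by (rule summable_mult)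
  fix k
  have "t k \<noteq> 0" using t[of k] by simp
  then have "(s k)\<^sup>2 * (2 * E k + 2 * (t k)\<^sup>2 * (s k)\<^sup>2) = 2 * ((t k * (s k)\<^sup>2) * (E k / t k + t k * (s k)\<^sup>2))"
    by (simp add: field_simps power2_eq_square)
  with u[of k] show "norm (u k) \<le> 2 * ((t k * (s k)\<^sup>2) * (E k / t k + t k * (s k)\<^sup>2))"
    by (simp only: real_norm_def abs_of_nonneg)
qed

lemma a_summable: "summable (\<lambda>k. \<integral>\<omega>. (a k \<omega>)\<^sup>2 \<partial>M)"
proof (rule summable_noise_product[OF lam_pos _ sum_V summable_EF_EW(1)])
  fix k
  show "(\<integral>\<omega>. (a k \<omega>)\<^sup>2 \<partial>M) \<le> (\<sigma> k)\<^sup>2 * (2 * EF k + 2 * (lam k)\<^sup>2 * (\<sigma> k)\<^sup>2)"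
    by (rule order_trans[OF a_props(2)]) (intro mult_left_mono EF_mean_le, simp)
qed simp_all

lemma b_summable: "summable (\<lambda>k. \<integral>\<omega>. (b k \<omega>)\<^sup>2 \<partial>M)"
proof (rule summable_noise_product[OF lamp_pos _ sum_Vp summable_EF_EW(2)])
  fix k
  show "(\<integral>\<omega>. (b k \<omega>)\<^sup>2 \<partial>M) \<le> (\<sigma>\<^sub>p k)\<^sup>2 * (2 * EW k + 2 * (lam\<^sub>p k)\<^sup>2 * (\<sigma>\<^sub>p k)\<^sup>2)"
    by (rule order_trans[OF b_props(2)]) (intro mult_left_mono EW_mean_le, simp)
qed simp_all

text \<open>Summable absolute means give almost sure absolute convergence of the series and its
  integration term by term. Every summand of r is summable in mean by itself, the D term through
  \<open>step_coefficients\<close>.\<close>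

lemma r_summable: "summable (\<lambda>k. \<integral>\<omega>. \<bar>r k \<omega>\<bar> \<partial>M)"
proof (rule summable_comparison_test')
  show "summable (\<lambda>k. 2 * (EF k / lam k) + EW k / lam\<^sub>p k + lam k * (\<sigma> k)\<^sup>2 + lam\<^sub>p k * (\<sigma>\<^sub>p k)\<^sup>2)"
    by (intro summable_add summable_mult summable_EF_EW sum_V sum_Vp)
  fix k
  let ?p = "\<lambda>\<omega>. (\<kappa> k)\<^sup>2 * (norm (D k \<omega>))\<^sup>2 / lam\<^sub>p k + (norm (F k \<omega>))\<^sup>2 / (2 * lam\<^sub>p k)
     + (norm (F k \<omega>))\<^sup>2 / lam k + (norm (W k \<omega>))\<^sup>2 / (4 * lam\<^sub>p k)
     + lam k * (norm (grad f (X k \<omega>) - V k \<omega>))\<^sup>2 + lam\<^sub>p k * (norm (grad f (Z k \<omega>) - V\<^sub>p k \<omega>))\<^sup>2"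
  have "(\<integral>\<omega>. \<bar>r k \<omega>\<bar> \<partial>M) \<le> (\<integral>\<omega>. ?p \<omega> \<partial>M)"
  proof (rule integral_mono)
    fix \<omega>
    have "0 \<le> (\<kappa> k)\<^sup>2 * (norm (D k \<omega>))\<^sup>2 / lam\<^sub>p k" "0 \<le> (norm (F k \<omega>))\<^sup>2 / (2 * lam\<^sub>p k)"
        "0 \<le> (norm (F k \<omega>))\<^sup>2 / lam k" "0 \<le> (norm (W k \<omega>))\<^sup>2 / (4 * lam\<^sub>p k)"
        "0 \<le> lam k * (norm (grad f (X k \<omega>) - V k \<omega>))\<^sup>2"
        "0 \<le> lam\<^sub>p k * (norm (grad f (Z k \<omega>) - V\<^sub>p k \<omega>))\<^sup>2"
      using lam_pos[of k] lamp_pos[of k] by simp_all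
    then show "\<bar>r k \<omega>\<bar> \<le> ?p \<omega>" unfolding r_def by linarith
  qed (use r_int norm_sq_int in auto)
  also have "\<dots> = (\<kappa> k)\<^sup>2 * (\<integral>\<omega>. (norm (D k \<omega>))\<^sup>2 \<partial>M) / lam\<^sub>p k + EF k / (2 * lam\<^sub>p k)
     + EF k / lam k + EW k / (4 * lam\<^sub>p k)
     + lam k * (\<integral>\<omega>. (norm (grad f (X k \<omega>) - V k \<omega>))\<^sup>2 \<partial>M)
     + lam\<^sub>p k * (\<integral>\<omega>. (norm (grad f (Z k \<omega>) - V\<^sub>p k \<omega>))\<^sup>2 \<partial>M)"
    using norm_sq_int by simp
  also have "\<dots> \<le> (1 - \<rho>) * EF k / lam k + EF k / lam k + EW k / (4 * lam\<^sub>p k)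
      + lam k * (\<sigma> k)\<^sup>2 + lam\<^sub>p k * (\<sigma>\<^sub>p k)\<^sup>2"
    using step_coefficients[of k] noise_le[of k] by linarith
  also have "\<dots> \<le> 2 * (EF k / lam k) + EW k / lam\<^sub>p k + lam k * (\<sigma> k)\<^sup>2 + lam\<^sub>p k * (\<sigma>\<^sub>p k)\<^sup>2"
  proof -
    have "0 \<le> \<rho> * EF k / lam k" using rho lam_pos[of k] by simp
    moreover have "0 \<le> EW k / lam\<^sub>p k" using lamp_pos[of k] by simp
    moreover have "EW k / (4 * lam\<^sub>p k) = EW k / lam\<^sub>p k / 4" by simp
    moreover have "(1 - \<rho>) * EF k / lam k = EF k / lam k - \<rho> * EF k / lam k"
      by (simp add: left_diff_distrib diff_divide_distrib)
    ultimately show ?thesis by linarith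
  qed
  finally show "norm (\<integral>\<omega>. \<bar>r k \<omega>\<bar> \<partial>M)
      \<le> 2 * (EF k / lam k) + EW k / lam\<^sub>p k + lam k * (\<sigma> k)\<^sup>2 + lam\<^sub>p k * (\<sigma>\<^sub>p k)\<^sup>2"
    by simp
qed

lemma P_convergence:
  "\<exists>Y. integrable M Y \<and> (AE \<omega> in M. (\<lambda>k. P k \<omega>) \<longlonglongrightarrow> Y \<omega>)
    \<and> (\<lambda>k. \<integral>\<omega>. P k \<omega> \<partial>M) \<longlonglongrightarrow> (\<integral>\<omega>. Y \<omega> \<partial>M)"
proof -
  obtain A where A: "integrable M A" "(\<integral>\<omega>. A \<omega> \<partial>M) = 0" "AE \<omega> in M. (\<lambda>n. a.S n \<omega>) \<longlonglongrightarrow> A \<omega>"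
    using a.L2_limit[OF a_summable] by auto
  obtain B where B: "integrable M B" "(\<integral>\<omega>. B \<omega> \<partial>M) = 0" "AE \<omega> in M. (\<lambda>n. b.S n \<omega>) \<longlonglongrightarrow> B \<omega>"
    using b.L2_limit[OF b_summable] by auto
  have r: "AE \<omega> in M. summable (\<lambda>k. \<bar>r k \<omega>\<bar>)"
    by (rule AE_summable_of_integrable_sum[OF r_int r_summable])
  let ?R = "\<lambda>\<omega>. \<Sum>k. r k \<omega>"
  have R: "integrable M ?R" "(\<lambda>k. \<integral>\<omega>. r k \<omega> \<partial>M) sums (\<integral>\<omega>. ?R \<omega> \<partial>M)"
    using r r_int r_summable by (auto intro!: integrable_suminf sums_integral)
  let ?s = "\<lambda>k \<omega>. a k \<omega> + b k \<omega> + r k \<omega>" and ?S = "\<lambda>\<omega>. A \<omega> + B \<omega> + ?R \<omega>"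
  have s: "integrable M (?s k)" for k
    by (intro Bochner_Integration.integrable_add a_int b_int r_int)
  have S: "integrable M ?S" by (intro Bochner_Integration.integrable_add A B R)
  have sum_s: "AE \<omega> in M. (\<lambda>n. \<Sum>j<n. ?s j \<omega>) \<longlonglongrightarrow> ?S \<omega>"
    using A(3) B(3) r
  proof eventually_elim
    case (elim \<omega>)
    have "(\<lambda>n. \<Sum>j<n. r j \<omega>) \<longlonglongrightarrow> ?R \<omega>"
      by (rule summable_LIMSEQ[OF summable_rabs_cancel[OF elim(3)]])
    from tendsto_add[OF tendsto_add[OF elim(1,2)] this] show ?case by (simp only: sum.distrib)
  qed
  \<comment> \<open>The martingale parts have mean zero at each step and in the limit, so the
    convergence of the means rests on r alone.\<close>
  have "(\<integral>\<omega>. ?s k \<omega> \<partial>M) = (\<integral>\<omega>. r k \<omega> \<partial>M)" for k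
    using a_int b_int r_int by (simp add: a.integral_m b.integral_m)
  moreover have "(\<integral>\<omega>. ?S \<omega> \<partial>M) = (\<integral>\<omega>. ?R \<omega> \<partial>M)"
    using A(1,2) B(1,2) R(1) by simp
  ultimately have int_s: "(\<lambda>n. \<Sum>j<n. \<integral>\<omega>. ?s j \<omega> \<partial>M) \<longlonglongrightarrow> (\<integral>\<omega>. ?S \<omega> \<partial>M)"
    using R(2) by (simp add: sums_def)
  show ?thesis
    by (rule perturbed_decreasing_convergence[OF P_int AE_I2[OF P_lower] AE_I2[OF P_step] s S sum_s int_s])
qed

section \<open>The natural residual along the process\<close>

definition res :: "nat \<Rightarrow> 'a \<Rightarrow> real^'n" where
  "res k \<omega> = X k \<omega> - px 1 (X k \<omega> - grad f (X k \<omega>))"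

lemma res_sq: "square_integrable M (res k)"
  unfolding res_def[abs_def]
  by (intro square_integrable_diff X_sq grad_X_sq square_integrable_lipschitz_compose[OF px_lipschitz]) simp

text \<open>Scaling gives lam^2 E|res|^2 \<le> E|F_mean|^2, and the right-hand side is summable
  after division by lam. One factor lam remains as the weight, which is where divergence of the sum
  of the step sizes applies.\<close>

lemma weighted_res_le:
  "lam k * (\<integral>\<omega>. (norm (res k \<omega>))\<^sup>2 \<partial>M) \<le> 2 * (EF k / lam k) + 2 * (lam k * (\<sigma> k)\<^sup>2)"
proof -
  have "(\<integral>\<omega>. (lam k)\<^sup>2 * (norm (res k \<omega>))\<^sup>2 \<partial>M) \<le> (\<integral>\<omega>. (norm (F_mean k \<omega>))\<^sup>2 \<partial>M)"
  proof (rule integral_mono)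
    fix \<omega>
    have "lam k * norm (res k \<omega>) \<le> norm (F_mean k \<omega>)"
      unfolding res_def F_mean_def by (rule residual_scaling[OF lam_pos lam_le_1])
    then have "(lam k * norm (res k \<omega>))\<^sup>2 \<le> (norm (F_mean k \<omega>))\<^sup>2"
      using lam_pos[of k] by (intro power_mono) auto
    then show "(lam k)\<^sup>2 * (norm (res k \<omega>))\<^sup>2 \<le> (norm (F_mean k \<omega>))\<^sup>2" by (simp add: power_mult_distrib)
  qed (use square_integrable_norm_sq[OF res_sq] square_integrable_norm_sq[OF F_mean_sq] in auto)
  also have "\<dots> \<le> 2 * EF k + 2 * (lam k)\<^sup>2 * (\<sigma> k)\<^sup>2" by (rule EF_mean_le)
  finally show ?thesis using lam_pos[of k] by (simp add: field_simps power2_eq_square)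
qed

lemma weighted_res_finite:
  "(\<Sum>k. ennreal (lam k) * (\<integral>\<^sup>+\<omega>. ennreal ((norm (res k \<omega>))\<^sup>2) \<partial>M)) < \<infinity>"
proof -
  let ?w = "\<lambda>k. lam k * (\<integral>\<omega>. (norm (res k \<omega>))\<^sup>2 \<partial>M)"
  have w0: "0 \<le> ?w k" for k using lam_pos[of k] by simp
  have "summable ?w"
  proof (rule summable_comparison_test')
    show "summable (\<lambda>k. 2 * (EF k / lam k) + 2 * (lam k * (\<sigma> k)\<^sup>2))"
      by (intro summable_add summable_mult summable_EF_EW sum_V)
    show "norm (?w k) \<le> 2 * (EF k / lam k) + 2 * (lam k * (\<sigma> k)\<^sup>2)" for k
      using weighted_res_le[of k] w0[of k] by simp
  qed
  then have "(\<Sum>k. ennreal (?w k)) \<noteq> top" using w0 by (intro ennreal_suminf_neq_top) auto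
  moreover have "ennreal (lam k) * (\<integral>\<^sup>+\<omega>. ennreal ((norm (res k \<omega>))\<^sup>2) \<partial>M) = ennreal (?w k)" for k
    using nn_integral_eq_integral[OF square_integrable_norm_sq[OF res_sq[of k]]] lam_pos[of k]
    by (simp add: ennreal_mult')
  ultimately show ?thesis by (simp add: less_top[symmetric])
qed

context
  assumes lam_inf: "(\<Sum>k. ennreal (lam k)) = \<infinity>"
begin

lemma liminf_expected_res: "liminf (\<lambda>k. \<integral>\<^sup>+\<omega>. ennreal ((norm (res k \<omega>))\<^sup>2) \<partial>M) = 0"
  by (rule liminf_eq_0_if_weighted_summable[OF lam_inf weighted_res_finite])

lemma AE_liminf_res: "AE \<omega> in M. liminf (\<lambda>k. ereal (norm (res k \<omega>))) = 0"
proof -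
  have [measurable]: "res k \<in> borel_measurable M" for k by (rule square_integrable_measurable[OF res_sq])
  have "(\<integral>\<^sup>+\<omega>. (\<Sum>k. ennreal (lam k) * ennreal ((norm (res k \<omega>))\<^sup>2)) \<partial>M)
      = (\<Sum>k. \<integral>\<^sup>+\<omega>. ennreal (lam k) * ennreal ((norm (res k \<omega>))\<^sup>2) \<partial>M)"
    by (rule nn_integral_suminf) measurable
  also have "\<dots> = (\<Sum>k. ennreal (lam k) * (\<integral>\<^sup>+\<omega>. ennreal ((norm (res k \<omega>))\<^sup>2) \<partial>M))"
    by (intro suminf_cong nn_integral_cmult) measurable
  finally have "AE \<omega> in M. (\<Sum>k. ennreal (lam k) * ennreal ((norm (res k \<omega>))\<^sup>2)) \<noteq> \<infinity>"
    using weighted_res_finite by (intro nn_integral_PInf_AE) auto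
  then show ?thesis
  proof eventually_elim
    case (elim \<omega>)
    then have lim0: "liminf (\<lambda>k. ennreal ((norm (res k \<omega>))\<^sup>2)) = 0"
      by (intro liminf_eq_0_if_weighted_summable[OF lam_inf]) (simp add: less_top[symmetric])
    \<comment> \<open>Passage from the squares in \<open>ennreal\<close> to the norms in
      \<open>ereal\<close>: a level e below the lower limit of the norms gives the level e^2 for the
      squares.\<close>
    show ?case
    proof (rule ccontr)
      let ?l = "liminf (\<lambda>k. ereal (norm (res k \<omega>)))"
      assume "?l \<noteq> 0"
      moreover have "0 \<le> ?l" by (intro Liminf_bounded) simp
      ultimately obtain e where e: "0 < ereal e" "ereal e < ?l"
        using ereal_dense2[of 0 ?l] by (auto simp: order.strict_iff_order)
      have "\<forall>\<^sub>F k in sequentially. ennreal (e\<^sup>2) \<le> ennreal ((norm (res k \<omega>))\<^sup>2)"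
        using less_LiminfD[OF e(2)]
      proof eventually_elim
        case (elim k)
        then show ?case using e(1) by (intro ennreal_leI power_mono) auto
      qed
      then have "ennreal (e\<^sup>2) \<le> 0" unfolding lim0[symmetric] by (rule Liminf_bounded)
      then show False using e(1) by simp
    qed
  qed
qed

end

end

section \<open>The filtration of the method\<close>

lemma subalgebra_sigma:
  assumes "A \<subseteq> sets M"
  shows "subalgebra M (sigma (space M) A)" "A \<subseteq> sets (sigma (space M) A)"
proof -
  have "A \<subseteq> Pow (space M)" using assms sets.space_closed by blast
  then show "A \<subseteq> sets (sigma (space M) A)" "subalgebra M (sigma (space M) A)"
    using assms by (auto simp: subalgebra_def space_measure_of_conv sets.sigma_sets_subset
      intro: sigma_sets.Basic dest: subsetD[OF sets.sigma_sets_subset[OF assms]])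
qed

lemma generated_by_subset: "V \<in> borel_measurable M \<Longrightarrow> sets (generated_by M V) \<subseteq> sets M"
  by (auto simp: generated_by_def sets_vimage_algebra2 measurable_sets)

lemma measurable_if_generated_by_subset:
  assumes "space N = space M" "sets (generated_by M V) \<subseteq> sets N"
  shows "V \<in> borel_measurable N"
  using assms by (intro measurableI) (auto simp: generated_by_def sets_vimage_algebra2)

lemma filt_generators_subset:
  assumes "\<And>k. V k \<in> borel_measurable M" "\<And>k. V\<^sub>p k \<in> borel_measurable M"
  shows "(\<Union>i\<le>k. sets (generated_by M (V i))) \<union> (\<Union>i<k. sets (generated_by M (V\<^sub>p i))) \<subseteq> sets M"
  using generated_by_subset[OF assms(1)] generated_by_subset[OF assms(2)] by blast

lemma filt_plus_generators_subset:
  assumes "\<And>k. V k \<in> borel_measurable M" "\<And>k. V\<^sub>p k \<in> borel_measurable M"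
  shows "sets (filt M V V\<^sub>p k) \<union> sets (generated_by M (V\<^sub>p k)) \<subseteq> sets M"
proof (rule Un_least)
  show "sets (filt M V V\<^sub>p k) \<subseteq> sets M"
    using subalgebra_sigma(1)[OF filt_generators_subset[where k = k, OF assms]]
    by (simp only: filt_def subalgebra_def)
qed (rule generated_by_subset[OF assms(2)])

text \<open>Provides the interleaved chain G 0, H 0, G 1, H 1, ... that the process locale expects,
  with G read as \<open>filt_plus_pred\<close> and H as \<open>filt\<close>. Both inclusions reduce
  to inclusions between generators.\<close>

lemma filtration_properties:
  fixes V V\<^sub>p :: "nat \<Rightarrow> 'a \<Rightarrow> real^'n"
  assumes V: "\<And>k. V k \<in> borel_measurable M" and Vp: "\<And>k. V\<^sub>p k \<in> borel_measurable M"
  shows "subalgebra M (filt M V V\<^sub>p k)" "subalgebra M (filt_plus_pred M V V\<^sub>p k)"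
    "sets (filt_plus_pred M V V\<^sub>p k) \<subseteq> sets (filt M V V\<^sub>p k)"
    "sets (filt M V V\<^sub>p k) \<subseteq> sets (filt_plus_pred M V V\<^sub>p (Suc k))"
    "V k \<in> borel_measurable (filt M V V\<^sub>p k)"
    "V\<^sub>p k \<in> borel_measurable (filt_plus_pred M V V\<^sub>p (Suc k))"
proof -
  have fs: "subalgebra M (filt M V V\<^sub>p k)"
    "(\<Union>i\<le>k. sets (generated_by M (V i))) \<union> (\<Union>i<k. sets (generated_by M (V\<^sub>p i))) \<subseteq> sets (filt M V V\<^sub>p k)" for k
    unfolding filt_def by (intro subalgebra_sigma filt_generators_subset V Vp)+
  have ps: "subalgebra M (filt_plus M V V\<^sub>p k)"
    "sets (filt M V V\<^sub>p k) \<union> sets (generated_by M (V\<^sub>p k)) \<subseteq> sets (filt_plus M V V\<^sub>p k)" for k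
    unfolding filt_plus_def by (intro subalgebra_sigma filt_plus_generators_subset V Vp)+
  show "subalgebra M (filt M V V\<^sub>p k)" by (rule fs)
  show "subalgebra M (filt_plus_pred M V V\<^sub>p k)"
    using subalgebra_sigma(1)[of "{}" M] ps by (cases k) (simp_all add: filt_plus_pred_def)
  show "sets (filt M V V\<^sub>p k) \<subseteq> sets (filt_plus_pred M V V\<^sub>p (Suc k))"
    using ps by (simp add: filt_plus_pred_def)
  show "V k \<in> borel_measurable (filt M V V\<^sub>p k)"
    using fs[of k] by (intro measurable_if_generated_by_subset[of _ M]) (auto simp: subalgebra_def)
  show "V\<^sub>p k \<in> borel_measurable (filt_plus_pred M V V\<^sub>p (Suc k))"
    using ps[of k] by (intro measurable_if_generated_by_subset[of _ M]) (auto simp: subalgebra_def filt_plus_pred_def)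
  show "sets (filt_plus_pred M V V\<^sub>p k) \<subseteq> sets (filt M V V\<^sub>p k)"
  proof (cases k)
    case 0
    have "sets (sigma (space M) {}) \<subseteq> sets (filt M V V\<^sub>p 0)"
      using fs(1)[of 0] by (auto simp: subalgebra_def sigma_sets_empty_eq) (metis sets.top)
    then show ?thesis using 0 by (simp add: filt_plus_pred_def)
  next
    case (Suc j)
    have sp: "space (filt M V V\<^sub>p k) = space M" using fs by (simp add: subalgebra_def)
    have "sets (filt M V V\<^sub>p j) \<subseteq> sets (filt M V V\<^sub>p k)"
    proof -
      have "(\<Union>i\<le>j. sets (generated_by M (V i))) \<union> (\<Union>i<j. sets (generated_by M (V\<^sub>p i))) \<subseteq> sets (filt M V V\<^sub>p k)"
        by (rule order_trans[OF Un_mono[OF UN_mono UN_mono] fs(2)[of k]]) (auto simp: Suc)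
      \<comment> \<open>\<open>subalgebra_sigma\<close> is used with the \<sigma>-algebra
        \<open>filt\<close> at k in the role of the ambient measure: what is generated by members of
        it stays inside it.\<close>
      then have "sets (sigma (space (filt M V V\<^sub>p k))
          ((\<Union>i\<le>j. sets (generated_by M (V i))) \<union> (\<Union>i<j. sets (generated_by M (V\<^sub>p i))))) \<subseteq> sets (filt M V V\<^sub>p k)"
        using subalgebra_sigma(1)[of _ "filt M V V\<^sub>p k"] by (simp only: subalgebra_def)
      then show ?thesis by (simp only: sp filt_def[of M V V\<^sub>p j])
    qed
    moreover have "sets (generated_by M (V\<^sub>p j)) \<subseteq> sets (filt M V V\<^sub>p k)"
      using fs(2)[of k] Suc by blast
    ultimately have "sets (sigma (space (filt M V V\<^sub>p k))
        (sets (filt M V V\<^sub>p j) \<union> sets (generated_by M (V\<^sub>p j)))) \<subseteq> sets (filt M V V\<^sub>p k)"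
      using subalgebra_sigma(1)[of _ "filt M V V\<^sub>p k"] by (simp only: subalgebra_def Un_subset_iff)
    moreover have "filt_plus_pred M V V\<^sub>p k = filt_plus M V V\<^sub>p j"
      by (simp add: Suc filt_plus_pred_def)
    ultimately show ?thesis by (simp only: sp filt_plus_def)
  qed
qed

theorem theorem3p2:
  fixes M :: "'a measure"
    and f :: "real^'n \<Rightarrow> real" and \<phi> \<psi> :: "real^'n \<Rightarrow> ereal"
    and x0 :: "real^'n"
    and \<alpha> \<beta> lam lam\<^sub>p \<nu> \<sigma> \<sigma>\<^sub>p :: "nat \<Rightarrow> real"
    and L\<^sub>f \<rho> :: real
    and \<Lambda> \<Lambda>\<^sub>p :: "nat \<Rightarrow> real^'n^'n"
    and V D V\<^sub>p X Z :: "nat \<Rightarrow> 'a \<Rightarrow> real^'n"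
  defines "\<psi> \<equiv> \<lambda>x. ereal (f x) + \<phi> x"
    and "\<Lambda> \<equiv> \<lambda>k. inverse (lam k) *\<^sub>R mat 1"
    and "\<Lambda>\<^sub>p \<equiv> \<lambda>k. inverse (lam\<^sub>p k) *\<^sub>R mat 1"
  assumes "prob_space M"
    and "cont_diff f"
    and "proper_fun \<phi>" and "convex_fun \<phi>" and "lsc_fun \<phi>"
    and "\<And>k. 0 < lam k" and "\<And>k. 0 < lam\<^sub>p k"
    and "stochastic_extra_step M \<phi> x0 \<alpha> \<beta> \<Lambda>\<^sub>p V D V\<^sub>p X Z"
    and A1: "1 \<le> L\<^sub>f" "L\<^sub>f-lipschitz_on UNIV (grad f)"
    and A2: "\<exists>c::real. \<forall>x\<in>domain_of \<phi>. ereal c \<le> \<psi> x"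
    and B1: "\<And>k. D k \<in> borel_measurable (filt M V V\<^sub>p k)"
    and B2: "\<And>k. 0 < \<nu> k"
      "\<And>k. AE \<omega> in M. cond_sq_norm M (filt_plus_pred M V V\<^sub>p k) (D k) \<omega>
         \<le> ennreal ((\<nu> k)\<^sup>2) * cond_sq_norm M (filt_plus_pred M V V\<^sub>p k)
              (\<lambda>\<omega>. residual_at (\<Lambda> k) \<phi> (V k \<omega>) (X k \<omega>)) \<omega>"
    and B3_mean:
      "\<And>k. AE \<omega> in M. vec_cond_exp M (filt_plus_pred M V V\<^sub>p k) (V k) \<omega> = grad f (X k \<omega>)"
      "\<And>k. AE \<omega> in M. vec_cond_exp M (filt M V V\<^sub>p k) (V\<^sub>p k) \<omega> = grad f (Z k \<omega>)"
    and B3_var: "\<And>k. 0 < \<sigma> k" "\<And>k. 0 < \<sigma>\<^sub>p k"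
      "\<And>k. AE \<omega> in M. cond_sq_norm M (filt_plus_pred M V V\<^sub>p k)
         (\<lambda>\<omega>. grad f (X k \<omega>) - V k \<omega>) \<omega> \<le> ennreal ((\<sigma> k)\<^sup>2)"
      "\<And>k. AE \<omega> in M. cond_sq_norm M (filt M V V\<^sub>p k)
         (\<lambda>\<omega>. grad f (Z k \<omega>) - V\<^sub>p k \<omega>) \<omega> \<le> ennreal ((\<sigma>\<^sub>p k)\<^sup>2)"
    and "0 < \<rho>" and "\<rho> < 1"
    and "\<And>k. lam\<^sub>p k \<le> 1 / L\<^sub>f"
    and "\<And>k. lam k \<le>
           (1 - \<rho>) * lam\<^sub>p k / (1 + (\<nu> k)\<^sup>2 * (\<alpha> k + L\<^sub>f * \<beta> k * lam\<^sub>p k)\<^sup>2)"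
    and "(\<Sum>k. ennreal (lam k)) = \<infinity>"
    and "summable (\<lambda>k. lam k * (\<sigma> k)\<^sup>2)"
    and "summable (\<lambda>k. lam\<^sub>p k * (\<sigma>\<^sub>p k)\<^sup>2)"
  shows "liminf (\<lambda>k. \<integral>\<^sup>+\<omega>. ennreal ((norm (residual (mat 1) f \<phi> (X k \<omega>)))\<^sup>2) \<partial>M) = 0
    \<and> (AE \<omega> in M. liminf (\<lambda>k. ereal (norm (residual (mat 1) f \<phi> (X k \<omega>)))) = 0)
    \<and> (\<forall>k. (AE \<omega> in M. \<bar>\<psi> (X k \<omega>)\<bar> \<noteq> \<infinity>) \<and>
           integrable M (\<lambda>\<omega>. real_of_ereal (\<psi> (X k \<omega>))))
    \<and> (\<exists>Y. integrable M Y
         \<and> (AE \<omega> in M. (\<lambda>k. \<psi> (X k \<omega>)) \<longlonglongrightarrow> ereal (Y \<omega>))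
         \<and> (\<lambda>k. \<integral>\<omega>. real_of_ereal (\<psi> (X k \<omega>)) \<partial>M) \<longlonglongrightarrow> (\<integral>\<omega>. Y \<omega> \<partial>M))"
proof -
  interpret convex_lsc_proper \<phi> by unfold_locales fact+
  obtain c where c: "\<And>x. x \<in> domain_of \<phi> \<Longrightarrow> ereal c \<le> \<psi> x" using A2 by blast
  have psi: "\<psi> x = ereal (f x + \<phi>r x)" if "x \<in> domain_of \<phi>" for x
    unfolding \<psi>_def using dom_ereal[OF that] by (metis plus_ereal.simps(1))
  note ses = \<open>stochastic_extra_step M \<phi> x0 \<alpha> \<beta> \<Lambda>\<^sub>p V D V\<^sub>p X Z\<close>[unfolded stochastic_extra_step_def]
  have V: "\<And>k. V k \<in> borel_measurable M" and Vp: "\<And>k. V\<^sub>p k \<in> borel_measurable M" using ses by auto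
  note filtration = filtration_properties[of V M V\<^sub>p, OF V Vp]
  interpret extra_step_process M \<phi> f x0 \<alpha> \<beta> lam lam\<^sub>p \<nu> \<sigma> \<sigma>\<^sub>p L\<^sub>f \<rho> c
    "filt_plus_pred M V V\<^sub>p" "filt M V V\<^sub>p" V D V\<^sub>p X Z
  proof (intro extra_step_process.intro extra_step_process_axioms.intro convex_lsc_proper_axioms
      filtration B1 B3_mean B3_var A1 assms)
    show "c \<le> f x + \<phi>r x" if "x \<in> domain_of \<phi>" for x using c[OF that] psi[OF that] by simp
    show "AE \<omega> in M. cond_sq_norm M (filt_plus_pred M V V\<^sub>p k) (D k) \<omega> \<le> ennreal ((\<nu> k)\<^sup>2) *
      cond_sq_norm M (filt_plus_pred M V V\<^sub>p k) (\<lambda>\<omega>. X k \<omega> - px (lam k) (X k \<omega> - lam k *\<^sub>R V k \<omega>)) \<omega>" for k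
      using B2(2)[of k] by (simp add: \<Lambda>_def residual_at_scaled_mat_1 assms)
    show "X (Suc k) \<omega> = px (lam\<^sub>p k) (X k \<omega> + \<alpha> k *\<^sub>R D k \<omega> - lam\<^sub>p k *\<^sub>R V\<^sub>p k \<omega>)" if "\<omega> \<in> space M" for \<omega> k
      using ses that \<open>\<And>k. 0 < lam\<^sub>p k\<close> by (simp add: \<Lambda>\<^sub>p_def px_def matrix_inv_scaled_mat_1)
  qed (use ses in auto)
  \<comment> \<open>Every X k lies in the domain, the first by assumption and the later ones as
    proximal points, so the extended-real \<psi> agrees with \<open>P\<close> on the whole space and
    not merely almost everywhere.\<close>
  have psi_X: "\<psi> (X k \<omega>) = ereal (P k \<omega>)" if "\<omega> \<in> space M" for k \<omega>
    using psi[OF X_dom[OF that]] by (simp add: P_def)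
  have res_eq: "residual (mat 1) f \<phi> (X k \<omega>) = res k \<omega>" for k \<omega>
    by (simp add: residual_mat_1 res_def)
  have int_eq: "integrable M (\<lambda>\<omega>. real_of_ereal (\<psi> (X k \<omega>))) \<longleftrightarrow> integrable M (P k)"
    "(\<integral>\<omega>. real_of_ereal (\<psi> (X k \<omega>)) \<partial>M) = (\<integral>\<omega>. P k \<omega> \<partial>M)" for k
    by (auto intro!: Bochner_Integration.integrable_cong Bochner_Integration.integral_cong simp: psi_X)
  obtain Y where Y: "integrable M Y" "AE \<omega> in M. (\<lambda>k. P k \<omega>) \<longlonglongrightarrow> Y \<omega>"
      "(\<lambda>k. \<integral>\<omega>. P k \<omega> \<partial>M) \<longlonglongrightarrow> (\<integral>\<omega>. Y \<omega> \<partial>M)"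
    using P_convergence by auto
  have "AE \<omega> in M. (\<lambda>k. \<psi> (X k \<omega>)) \<longlonglongrightarrow> ereal (Y \<omega>)"
    using Y(2) AE_space by eventually_elim (simp add: psi_X)
  moreover have "AE \<omega> in M. \<bar>\<psi> (X k \<omega>)\<bar> \<noteq> \<infinity>" for k
    using AE_space by eventually_elim (simp add: psi_X)
  moreover have lam_inf: "(\<Sum>k. ennreal (lam k)) = \<infinity>" by fact
  note liminf_expected_res[OF lam_inf] AE_liminf_res[OF lam_inf]
  ultimately show ?thesis
    using Y P_int unfolding res_eq int_eq by blast
qed

end
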